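(* Let $X$ be a Tychonoff topological space. The following assertions are equivalent: 1. $B_1(X)$ is Baire; 2. $B_1^{st}(X)$ is Baire; 3. every pairwise disjoint sequence $\{\Delta_n : n\in\mathbb{N}\}$ of non-empty finite subsets of $X$ has a subsequence $\{\Delta_{n_k} : k\in\mathbb{N}\}$ for which, writing $A=\bigcup_{k\in\mathbb{N}}\Delta_{n_k}$, there is a pairwise disjoint family $\{F_a : a\in A\}$ such that each $F_a$ is a zero-set neighborhood of $a$ (that is, a zero-set of $X$ containing $a$) and the family $\{F_a : a\in A\}$ is completely $Coz_\delta$-additive.
   Context: $\mathbb{N}$ is the set of positive integers and $\omega=\mathbb{N}\cup\{0\}$. A topological space is Baire if the intersection of any sequence of open dense subsets of it is dense in it. A function $f:X\to\mathbb{R}$ is a Baire-one function if it is the pointwise limit of a sequence of continuous functions $X\to\mathbb{R}$. $B_1(X)$ denotes the family of all Baire-one real-valued functions on $X$ endowed with the topology of pointwise convergence (the subspace topology from the product $\mathbb{R}^X$). A sequence $\{f_n\}_{n\in\omega}$ of functions $X\to\mathbb{R}$ stably converges to $f:X\to\mathbb{R}$ if for every $x\in X$ the set $\{n\in\omega : f_n(x)\neq f(x)\}$ is finite. $B_1^{st}(X)$ denotes the family of all functions $f:X\to\mathbb{R}$ for which there is a sequence of continuous functions $X\to\mathbb{R}$ stably converging to $f$, also endowed with the topology of pointwise convergence. A zero-set of $X$ is a set of the form $f^{-1}(0)$ with $f:X\to\mathbb{R}$ continuous; a cozero-set is the complement of a zero-set. A $Coz_\delta$-subset of $X$ is a countable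 intersection of cozero-sets of $X$. A "neighborhood" in the phrase "zero-set neighborhood of $a$" is not required to contain an open set around $a$: it means only a zero-set of $X$ containing $a$ (just as a "$Coz_\delta$ neighborhood" of $x$ means a $Coz_\delta$-subset containing $x$). A sequence of sets $\{\Delta_n\}$ is pairwise disjoint if $\Delta_n\cap\Delta_m=\emptyset$ for $n\neq m$; a family $\{F_a : a\in A\}$ is pairwise disjoint if $F_a\cap F_b=\emptyset$ for distinct $a,b\in A$. A family $\{F_a : a\in A\}$ of subsets of $X$ is completely $Coz_\delta$-additive if $\bigcup_{b\in B}F_b$ is a $Coz_\delta$-subset of $X$ for every $B\subseteq A$. *)

theory Defs
  imports "HOL-Analysis.Analysis"
begin

definition Tychonoff_space :: "'a topology \<Rightarrow> bool" where
  "Tychonoff_space X \<longleftrightarrow> completely_regular_space X \<and> Hausdorff_space X"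

definition Baire_space :: "'a topology \<Rightarrow> bool" where
  "Baire_space X \<longleftrightarrow>
     (\<forall>G :: nat \<Rightarrow> 'a set.
        (\<forall>n. openin X (G n) \<and> X closure_of (G n) = topspace X) \<longrightarrow>
        X closure_of (\<Inter>n. G n) = topspace X)"

text \<open>A real-valued function on the space \<open>X\<close> is represented by the HOL function that agrees
  with it on \<open>topspace X\<close> and is \<open>undefined\<close> elsewhere, which is how the points of
  \<open>powertop_real (topspace X)\<close>, the product of copies of the real line indexed by the points
  of \<open>X\<close>, are represented. The approximating continuous functions are not restricted
  in this way, since only their values on \<open>topspace X\<close> matter.\<close>

definition Baire_one :: "'a topology \<Rightarrow> ('a \<Rightarrow> real) set" where
  "Baire_one X =
     {f \<in> extensional (topspace X).
        \<exists>g :: nat \<Rightarrow> 'a \<Rightarrow> real.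
          (\<forall>n. continuous_map X euclideanreal (g n)) \<and>
          (\<forall>x \<in> topspace X. (\<lambda>n. g n x) \<longlonglongrightarrow> f x)}"

definition stably_converges_on :: "'a set \<Rightarrow> (nat \<Rightarrow> 'a \<Rightarrow> real) \<Rightarrow> ('a \<Rightarrow> real) \<Rightarrow> bool" where
  "stably_converges_on S g f \<longleftrightarrow> (\<forall>x \<in> S. finite {n. g n x \<noteq> f x})"

definition stable_Baire_one :: "'a topology \<Rightarrow> ('a \<Rightarrow> real) set" where
  "stable_Baire_one X =
     {f \<in> extensional (topspace X).
        \<exists>g :: nat \<Rightarrow> 'a \<Rightarrow> real.
          (\<forall>n. continuous_map X euclideanreal (g n)) \<and>
          stably_converges_on (topspace X) g f}"

definition B1_space :: "'a topology \<Rightarrow> ('a \<Rightarrow> real) topology" where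
  "B1_space X = subtopology (powertop_real (topspace X)) (Baire_one X)"

definition B1st_space :: "'a topology \<Rightarrow> ('a \<Rightarrow> real) topology" where
  "B1st_space X = subtopology (powertop_real (topspace X)) (stable_Baire_one X)"

definition zero_set :: "'a topology \<Rightarrow> 'a set \<Rightarrow> bool" where
  "zero_set X Z \<longleftrightarrow>
     (\<exists>f. continuous_map X euclideanreal f \<and> Z = {x \<in> topspace X. f x = 0})"

definition cozero_set :: "'a topology \<Rightarrow> 'a set \<Rightarrow> bool" where
  "cozero_set X U \<longleftrightarrow> (\<exists>Z. zero_set X Z \<and> U = topspace X - Z)"

text \<open>Since \<open>topspace X\<close> is itself a cozero-set, allowing finite or empty intersections
  would not add further sets.\<close>

definition Coz_delta :: "'a topology \<Rightarrow> 'a set \<Rightarrow> bool" where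
  "Coz_delta X S \<longleftrightarrow>
     (\<exists>U :: nat \<Rightarrow> 'a set. (\<forall>n. cozero_set X (U n)) \<and> S = (\<Inter>n. U n))"

definition completely_Coz_delta_additive ::
  "'a topology \<Rightarrow> 'i set \<Rightarrow> ('i \<Rightarrow> 'a set) \<Rightarrow> bool" where
  "completely_Coz_delta_additive X A F \<longleftrightarrow> (\<forall>B \<subseteq> A. Coz_delta X (\<Union>b\<in>B. F b))"

text \<open>A zero-set neighborhood of a point need not be a neighborhood in the topological sense: it
  is just a zero-set containing the point.\<close>

definition zero_set_nbhd :: "'a topology \<Rightarrow> 'a \<Rightarrow> 'a set \<Rightarrow> bool" where
  "zero_set_nbhd X a Z \<longleftrightarrow> zero_set X Z \<and> a \<in> Z"

end

theory Submission
  imports Defs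
begin

text \<open>
  Let \<open>E\<close> be any space of functions with \<open>stable_Baire_one X \<subseteq> E \<subseteq> Baire_one X\<close>, with the topology of
  pointwise convergence. It is shown that \<open>E\<close> is a Baire space if and only if every disjoint sequence
  of finite sets has a subsequence whose union can be separated as required. The theorem is the case
  of the two extreme choices of \<open>E\<close>.

  Suppose that \<open>E\<close> is Baire, and number the points of all the finite sets \<open>\<Delta> n\<close>. A basic open set of
  \<open>E\<close> restricts the values at finitely many points only, so a generic \<open>f \<in> E\<close> is close to the numbering
  on infinitely many \<open>\<Delta> n\<close>. On these it takes uniformly separated values. If continuous \<open>g n\<close> converge
  to \<open>f\<close>, then the zero-sets \<open>Z a\<close> of all points where each \<open>g n\<close> has the value \<open>g n a\<close> are as required
  (\<open>Baire_one_uniformly_separating\<close>).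

  Conversely, let \<open>G i\<close> be dense open sets. By density one can choose finite sets of new points and
  values there that force a function into \<open>G 0, \<dots>, G n\<close>. There are two obstacles. The choice has to
  work for a subsequence not known in advance; therefore the values are described as \<open>w + q\<close> with a
  background function \<open>w\<close>, and
  the choice at stage \<open>n\<close> is made to work no matter at which of the earlier points \<open>q\<close> is replaced
  by \<open>0\<close>. These are finitely many cases. Secondly, a dense open set need not contain functions with
  given exact values at the earlier points. So \<open>w\<close> is moved a little at each stage, by a
  continuous function that is uniformly small on \<open>X\<close>, and the final \<open>w\<close> is the uniform limit
  (\<open>generic_fusion\<close>). The separation hypothesis now applies to the sets of new points. It yields
  \<open>A\<close>, a union of infinitely many of them, and a stable limit of continuous functions
  that equals \<open>w + q\<close> on \<open>A\<close> and \<open>w\<close> at all other points used in the construction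
  (\<open>Coz_delta_separated_prescribed_values\<close>). This function lies in every \<open>G i\<close>.
\<close>

section \<open>Zero-sets and their countable unions\<close>

lemma uniform_limit_continuous_map_real:
  fixes f :: "nat \<Rightarrow> 'a \<Rightarrow> real"
  assumes "\<And>n. continuous_map X euclideanreal (f n)"
    and "uniform_limit (topspace X) f g sequentially"
  shows "continuous_map X euclideanreal g"
  using Met_TC.continuous_map_uniform_limit[where F = sequentially and X = X and f = f and g = g] assms
  by (auto simp: uniform_limit_iff mtopology_is_euclidean)

lemma zero_setI: "continuous_map X euclideanreal f \<Longrightarrow> zero_set X {x \<in> topspace X. f x = 0}"
  unfolding zero_set_def by blast

lemma zero_set_subset: "zero_set X Z \<Longrightarrow> Z \<subseteq> topspace X"
  unfolding zero_set_def by blast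

lemma zero_set_empty: "zero_set X {}"
  using zero_setI[of X "\<lambda>_. 1"] by simp

lemma zero_set_Un:
  assumes "zero_set X A" "zero_set X B"
  shows "zero_set X (A \<union> B)"
proof -
  obtain f g where "continuous_map X euclideanreal f" "A = {x \<in> topspace X. f x = 0}"
    and "continuous_map X euclideanreal g" "B = {x \<in> topspace X. g x = 0}"
    using assms unfolding zero_set_def by blast
  then show ?thesis
    using zero_setI[OF continuous_map_real_mult, of X f g]
    by (simp add: Un_def conj_disj_distribL)
qed

lemma zero_set_Union:
  assumes "finite I" "\<And>i. i \<in> I \<Longrightarrow> zero_set X (A i)"
  shows "zero_set X (\<Union>i\<in>I. A i)"
  using assms by (induction I rule: finite_induct) (auto simp: zero_set_empty zero_set_Un)

text \<open>If \<open>Z n\<close> is the zero-set of \<open>g n\<close>, the intersection is the zero-set of the uniformly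
  convergent sum of the functions \<open>min \<bar>g n\<bar> 1 / 2 ^ n\<close>, whose terms are non-negative.\<close>

lemma zero_set_Inter:
  fixes Z :: "nat \<Rightarrow> 'a set"
  assumes "\<And>n. zero_set X (Z n)"
  shows "zero_set X (\<Inter>n. Z n)"
proof -
  obtain g where g: "\<And>n. continuous_map X euclideanreal (g n)"
    and Z: "\<And>n. Z n = {x \<in> topspace X. g n x = 0}"
    using assms unfolding zero_set_def by metis
  define t where "t n x = min \<bar>g n x\<bar> 1 * (1/2) ^ n" for n x
  have t_bounds: "0 \<le> t n x" "t n x \<le> (1/2) ^ n" for n x
    unfolding t_def by (auto simp: mult_le_cancel_right1)
  have summ: "summable (\<lambda>n. t n x)" for x
    by (rule summable_comparison_test'[of "\<lambda>n. (1/2::real) ^ n" 0])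
       (use t_bounds in \<open>auto simp: summable_geometric\<close>)
  have "uniform_limit (topspace X) (\<lambda>n x. \<Sum>i<n. t i x) (\<lambda>x. \<Sum>i. t i x) sequentially"
    by (rule Weierstrass_m_test[where M = "\<lambda>n. (1/2) ^ n"])
       (use t_bounds in \<open>auto simp: summable_geometric\<close>)
  moreover have "continuous_map X euclideanreal (\<lambda>x. \<Sum>i<n. t i x)" for n
    unfolding t_def by (intro continuous_intros g continuous_map_const[THEN iffD2]) auto
  ultimately have cont: "continuous_map X euclideanreal (\<lambda>x. \<Sum>i. t i x)"
    by (rule uniform_limit_continuous_map_real[rotated])
  have "(\<Sum>i. t i x) = 0 \<longleftrightarrow> (\<forall>n. g n x = 0)" for x
    by (subst suminf_eq_zero_iff[OF summ t_bounds(1)]) (auto simp: t_def min_def)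
  then have "(\<Inter>n. Z n) = {x \<in> topspace X. (\<Sum>i. t i x) = 0}"
    unfolding Z by auto
  then show ?thesis
    using zero_setI[OF cont] by simp
qed

lemma zero_set_Int:
  assumes "zero_set X A" "zero_set X B"
  shows "zero_set X (A \<inter> B)"
proof -
  have "A \<inter> B = (\<Inter>n::nat. if n = 0 then A else B)"
    by (auto split: if_splits)
  then show ?thesis
    using zero_set_Inter[of X "\<lambda>n. if n = 0 then A else B"] assms by simp
qed

lemma zero_set_countable_Inter:
  assumes "countable I" "I \<noteq> {}" "\<And>i. i \<in> I \<Longrightarrow> zero_set X (Z i)"
  shows "zero_set X (\<Inter>i\<in>I. Z i)"
proof -
  have "(\<Inter>i\<in>I. Z i) = (\<Inter>n. Z (from_nat_into I n))"
    using arg_cong[OF range_from_nat_into[OF assms(2,1)], of "\<lambda>J. \<Inter>i\<in>J. Z i"] by simp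
  moreover have "zero_set X (Z (from_nat_into I n))" for n
    using assms(3) from_nat_into[OF assms(2)] by blast
  ultimately show ?thesis
    using zero_set_Inter[of X "\<lambda>n. Z (from_nat_into I n)"] by simp
qed

lemma zero_set_le:
  assumes "continuous_map X euclideanreal f"
  shows "zero_set X {x \<in> topspace X. f x \<le> c}"
proof -
  have "continuous_map X euclideanreal (\<lambda>x. max (f x - c) 0)"
    by (intro continuous_intros assms continuous_map_const[THEN iffD2]) auto
  moreover have "max (f x - c) 0 = 0 \<longleftrightarrow> f x \<le> c" for x
    by (auto simp: max_def)
  ultimately show ?thesis
    using zero_setI[of X "\<lambda>x. max (f x - c) 0"] by simp
qed

lemma zero_set_ge:
  assumes "continuous_map X euclideanreal f"
  shows "zero_set X {x \<in> topspace X. c \<le> f x}"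
proof -
  have "continuous_map X euclideanreal (\<lambda>x. - f x)"
    by (intro continuous_intros assms)
  from zero_set_le[OF this, of "-c"] show ?thesis by simp
qed

text \<open>The quotient \<open>\<bar>g\<bar> / (\<bar>f\<bar> + \<bar>g\<bar>)\<close> of functions with zero-sets \<open>A\<close> and \<open>B\<close> is
  continuous exactly because \<open>f\<close> and \<open>g\<close> have no common zero.\<close>

lemma zero_set_separation:
  assumes "zero_set X A" "zero_set X B" "A \<inter> B = {}"
  obtains h where "continuous_map X euclideanreal h"
    "\<And>x. x \<in> A \<Longrightarrow> h x = 1" "\<And>x. x \<in> B \<Longrightarrow> h x = 0"
proof -
  obtain f g where f: "continuous_map X euclideanreal f" "A = {x \<in> topspace X. f x = 0}"
    and g: "continuous_map X euclideanreal g" "B = {x \<in> topspace X. g x = 0}"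
    using assms(1,2) unfolding zero_set_def by blast
  have "\<bar>f x\<bar> + \<bar>g x\<bar> \<noteq> 0" if "x \<in> topspace X" for x
    using assms(3) that unfolding f g by auto
  then have "continuous_map X euclideanreal (\<lambda>x. \<bar>g x\<bar> / (\<bar>f x\<bar> + \<bar>g x\<bar>))"
    by (intro continuous_intros f g)
  moreover have "\<bar>g x\<bar> / (\<bar>f x\<bar> + \<bar>g x\<bar>) = 1" if "x \<in> A" for x
    using that assms(3) unfolding f g by auto
  moreover have "\<bar>g x\<bar> / (\<bar>f x\<bar> + \<bar>g x\<bar>) = 0" if "x \<in> B" for x
    using that unfolding g by auto
  ultimately show thesis by (rule that)
qed

text \<open>The complements of the \<open>Coz_delta\<close> sets. They form the more convenient half of the duality, as all
  the sets met below are obtained by countable unions and finite intersections.\<close>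

definition Zer_sigma :: "'a topology \<Rightarrow> 'a set \<Rightarrow> bool" where
  "Zer_sigma X S \<longleftrightarrow> (\<exists>Z :: nat \<Rightarrow> 'a set. (\<forall>n. zero_set X (Z n)) \<and> S = (\<Union>n. Z n))"

lemma zero_set_imp_Zer_sigma: "zero_set X Z \<Longrightarrow> Zer_sigma X Z"
  unfolding Zer_sigma_def by (intro exI[of _ "\<lambda>_. Z"]) auto

lemma Zer_sigma_UN_zero_sets:
  assumes "countable I" "\<And>i. i \<in> I \<Longrightarrow> zero_set X (Z i)"
  shows "Zer_sigma X (\<Union>i\<in>I. Z i)"
proof (cases "I = {}")
  case True
  then show ?thesis by (simp add: zero_set_empty zero_set_imp_Zer_sigma)
next
  case False
  have "(\<Union>i\<in>I. Z i) = (\<Union>n. Z (from_nat_into I n))"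
    using arg_cong[OF range_from_nat_into[OF False assms(1)], of "\<lambda>J. \<Union>i\<in>J. Z i"] by simp
  moreover have "\<forall>n. zero_set X (Z (from_nat_into I n))"
    using assms from_nat_into[OF False] by blast
  ultimately show ?thesis
    unfolding Zer_sigma_def by (intro exI[of _ "\<lambda>n. Z (from_nat_into I n)"]) simp
qed

lemma Zer_sigma_UN:
  fixes S :: "'i \<Rightarrow> 'a set"
  assumes "countable I" "\<And>i. i \<in> I \<Longrightarrow> Zer_sigma X (S i)"
  shows "Zer_sigma X (\<Union>i\<in>I. S i)"
proof -
  obtain Z :: "'i \<Rightarrow> nat \<Rightarrow> 'a set"
    where Z: "\<And>i. i \<in> I \<Longrightarrow> (\<forall>n. zero_set X (Z i n)) \<and> S i = (\<Union>n. Z i n)"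
    using assms(2) unfolding Zer_sigma_def by metis
  have "(\<Union>i\<in>I. S i) = (\<Union>p\<in>I \<times> UNIV. Z (fst p) (snd p))"
    using Z by fastforce
  then show ?thesis
    using Zer_sigma_UN_zero_sets[of "I \<times> (UNIV :: nat set)" X "\<lambda>p. Z (fst p) (snd p)"] assms(1) Z
    by auto
qed

lemma Zer_sigma_Un:
  assumes "Zer_sigma X S" "Zer_sigma X T"
  shows "Zer_sigma X (S \<union> T)"
  using Zer_sigma_UN[of "{True, False}" X "\<lambda>b. if b then S else T"] assms
  by (simp add: Un_commute split: if_splits)

lemma Zer_sigma_Int:
  assumes "Zer_sigma X S" "Zer_sigma X T"
  shows "Zer_sigma X (S \<inter> T)"
proof -
  obtain Y Z :: "nat \<Rightarrow> 'a set" where "\<forall>n. zero_set X (Y n)" "S = (\<Union>n. Y n)"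
    "\<forall>n. zero_set X (Z n)" "T = (\<Union>n. Z n)"
    using assms unfolding Zer_sigma_def by metis
  moreover have "(\<Union>n. Y n) \<inter> (\<Union>n. Z n) = (\<Union>p\<in>UNIV. Y (fst p) \<inter> Z (snd p))"
    by auto
  ultimately show ?thesis
    using Zer_sigma_UN_zero_sets[of UNIV X "\<lambda>p. Y (fst p) \<inter> Z (snd p)"] zero_set_Int[of X]
    by simp
qed

text \<open>Every cozero-set \<open>{f \<noteq> 0}\<close> is the union of the zero-sets \<open>{1 / (n + 1) \<le> \<bar>f\<bar>}\<close>; this is what
  lets a zero-set be cut out of another zero-set.\<close>

lemma Zer_sigma_Diff_zero_set:
  assumes "zero_set X Z"
  shows "Zer_sigma X (topspace X - Z)"
proof -
  obtain f where f: "continuous_map X euclideanreal f" "Z = {x \<in> topspace X. f x = 0}"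
    using assms unfolding zero_set_def by blast
  have "topspace X - Z = (\<Union>n. {x \<in> topspace X. inverse (real (Suc n)) \<le> \<bar>f x\<bar>})"
  proof -
    have "(\<exists>n. inverse (real (Suc n)) \<le> \<bar>f x\<bar>) \<longleftrightarrow> f x \<noteq> 0" for x
    proof
      assume "\<exists>n. inverse (real (Suc n)) \<le> \<bar>f x\<bar>"
      then obtain n where "inverse (real (Suc n)) \<le> \<bar>f x\<bar>" ..
      moreover have "0 < inverse (real (Suc n))" by simp
      ultimately show "f x \<noteq> 0" by linarith
    next
      assume "f x \<noteq> 0"
      then show "\<exists>n. inverse (real (Suc n)) \<le> \<bar>f x\<bar>"
        using reals_Archimedean[of "\<bar>f x\<bar>"] by (auto intro: less_imp_le)
    qed
    then show ?thesis unfolding f by auto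
  qed
  then show ?thesis
    using Zer_sigma_UN_zero_sets[of UNIV X "\<lambda>n. {x \<in> topspace X. inverse (real (Suc n)) \<le> \<bar>f x\<bar>}"]
      zero_set_ge[OF continuous_map_real_abs[OF f(1)]] by simp
qed

lemma Coz_delta_iff_Zer_sigma:
  "Coz_delta X S \<longleftrightarrow> S \<subseteq> topspace X \<and> Zer_sigma X (topspace X - S)"
proof
  assume "Coz_delta X S"
  then obtain U :: "nat \<Rightarrow> 'a set"
    where U: "\<forall>n. \<exists>Z. zero_set X Z \<and> U n = topspace X - Z" and SU: "S = (\<Inter>n. U n)"
    unfolding Coz_delta_def cozero_set_def by blast
  from choice[OF U] obtain Z
    where Z: "\<And>n. zero_set X (Z n)" and UZ: "\<And>n. U n = topspace X - Z n"
    by blast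
  have S: "S = (\<Inter>n. topspace X - Z n)"
    using SU UZ by simp
  have "topspace X - S = (\<Union>n. Z n)"
    using zero_set_subset[OF Z] unfolding S by auto
  then show "S \<subseteq> topspace X \<and> Zer_sigma X (topspace X - S)"
    using Z S unfolding Zer_sigma_def by blast
next
  assume R: "S \<subseteq> topspace X \<and> Zer_sigma X (topspace X - S)"
  then obtain Z where Z: "\<forall>n::nat. zero_set X (Z n)" "topspace X - S = (\<Union>n. Z n)"
    unfolding Zer_sigma_def by blast
  have "S = (\<Inter>n. topspace X - Z n)"
    using R Z(2) by auto
  moreover have "cozero_set X (topspace X - Z n)" for n
    unfolding cozero_set_def using Z(1) by blast
  ultimately show "Coz_delta X S"
    unfolding Coz_delta_def by (intro exI[of _ "\<lambda>n. topspace X - Z n"]) simp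
qed

section \<open>The topology of pointwise convergence\<close>

text \<open>Only the coordinates in \<open>S \<inter> I\<close> are constrained, so the box is a product of open sets almost all
  of which are the whole line.\<close>

lemma openin_box:
  assumes "finite S"
  shows "openin (powertop_real I) {g \<in> extensional I. \<forall>x \<in> S \<inter> I. \<bar>g x - f x\<bar> < \<epsilon>}"
proof -
  define U where "U i = (if i \<in> S then {y. \<bar>y - f i\<bar> < \<epsilon>} else UNIV)" for i
  have "open {y. \<bar>y - f i\<bar> < \<epsilon>}" for i
    by (intro open_Collect_less continuous_intros)
  then have "openin (powertop_real I) (\<Pi>\<^sub>E i\<in>I. U i)"
    using assms by (intro product_topology_basis) (auto simp: U_def elim: finite_subset[rotated])
  moreover have "(\<Pi>\<^sub>E i\<in>I. U i) = {g \<in> extensional I. \<forall>x \<in> S \<inter> I. \<bar>g x - f x\<bar> < \<epsilon>}"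
    unfolding U_def PiE_def Pi_def by (auto split: if_splits)
  ultimately show ?thesis by simp
qed

lemma openin_pointwise_iff:
  assumes E: "E \<subseteq> extensional I"
  shows "openin (subtopology (powertop_real I) E) G \<longleftrightarrow>
    G \<subseteq> E \<and> (\<forall>f\<in>G. \<exists>S \<epsilon>. finite S \<and> S \<subseteq> I \<and> 0 < \<epsilon> \<and>
      (\<forall>g\<in>E. (\<forall>x\<in>S. \<bar>g x - f x\<bar> < \<epsilon>) \<longrightarrow> g \<in> G))" (is "?L \<longleftrightarrow> ?R")
proof
  assume ?L
  then obtain T where T: "openin (powertop_real I) T" and G: "G = T \<inter> E"
    by (auto simp: openin_subtopology)
  have "\<exists>S \<epsilon>. finite S \<and> S \<subseteq> I \<and> 0 < \<epsilon> \<and> (\<forall>g\<in>E. (\<forall>x\<in>S. \<bar>g x - f x\<bar> < \<epsilon>) \<longrightarrow> g \<in> G)"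
    if "f \<in> G" for f
  proof -
    obtain U where fin: "finite {i \<in> I. U i \<noteq> UNIV}" and op: "\<forall>i\<in>I. open (U i)"
      and f: "f \<in> Pi\<^sub>E I U" and sub: "Pi\<^sub>E I U \<subseteq> T"
      using T \<open>f \<in> G\<close> unfolding G openin_product_topology_alt by auto
    define S where "S = {i \<in> I. U i \<noteq> UNIV}"
    have "\<exists>e>0. \<forall>y. \<bar>y - f i\<bar> < e \<longrightarrow> y \<in> U i" if "i \<in> S" for i
      using op f that unfolding S_def open_dist PiE_def Pi_def dist_real_def by blast
    then obtain e where e: "\<And>i. i \<in> S \<Longrightarrow> e i > (0::real)"
      "\<And>i y. i \<in> S \<Longrightarrow> \<bar>y - f i\<bar> < e i \<Longrightarrow> y \<in> U i" by metis
    define \<epsilon> where "\<epsilon> = Min (insert 1 (e ` S))"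
    have S: "finite S" "S \<subseteq> I" using fin unfolding S_def by auto
    have "\<epsilon> > 0" unfolding \<epsilon>_def using S e(1) by simp
    moreover have "g \<in> G" if "g \<in> E" "\<forall>x\<in>S. \<bar>g x - f x\<bar> < \<epsilon>" for g
    proof -
      have "g i \<in> U i" if "i \<in> I" for i
      proof (cases "i \<in> S")
        case True
        then have "\<epsilon> \<le> e i" unfolding \<epsilon>_def using S by simp
        with True \<open>\<forall>x\<in>S. \<bar>g x - f x\<bar> < \<epsilon>\<close> show ?thesis using e(2)[OF True, of "g i"] by fastforce
      next
        case False
        with that show ?thesis unfolding S_def by simp
      qed
      then have "g \<in> Pi\<^sub>E I U" using that(1) E by (auto simp: PiE_def)
      then show ?thesis using sub that(1) unfolding G by auto
    qed
    ultimately show ?thesis using S by blast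
  qed
  then show ?R using G by blast
next
  assume R: ?R
  show ?L
  proof (subst openin_subopen, intro ballI)
    fix f assume "f \<in> G"
    then obtain S \<epsilon> where S: "finite S" "S \<subseteq> I" "0 < \<epsilon>"
      and sub: "\<forall>g\<in>E. (\<forall>x\<in>S. \<bar>g x - f x\<bar> < \<epsilon>) \<longrightarrow> g \<in> G"
      using R by blast
    let ?B = "{g \<in> extensional I. \<forall>x \<in> S \<inter> I. \<bar>g x - f x\<bar> < \<epsilon>}"
    have "openin (subtopology (powertop_real I) E) (?B \<inter> E)"
      using openin_box[OF S(1)] by (auto simp: openin_subtopology)
    moreover have "f \<in> ?B \<inter> E" using R \<open>f \<in> G\<close> E S by auto
    moreover have "?B \<inter> E \<subseteq> G" using sub S by auto
    ultimately show "\<exists>T. openin (subtopology (powertop_real I) E) T \<and> f \<in> T \<and> T \<subseteq> G" by blast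
  qed
qed

lemma topspace_pointwise:
  "E \<subseteq> extensional I \<Longrightarrow> topspace (subtopology (powertop_real I) E) = E"
  by (auto simp: PiE_def)

lemma dense_pointwise_iff:
  assumes E: "E \<subseteq> extensional I" and G: "G \<subseteq> E"
  shows "subtopology (powertop_real I) E closure_of G = topspace (subtopology (powertop_real I) E) \<longleftrightarrow>
    (\<forall>f\<in>E. \<forall>S \<epsilon>. finite S \<and> S \<subseteq> I \<and> 0 < \<epsilon> \<longrightarrow> (\<exists>g\<in>G. \<forall>x\<in>S. \<bar>g x - f x\<bar> < \<epsilon>))" (is "?L \<longleftrightarrow> ?R")
proof
  assume L: ?L
  show ?R
  proof (intro ballI allI impI)
    fix f S and \<epsilon> :: real assume "f \<in> E" and S: "finite S \<and> S \<subseteq> I \<and> 0 < \<epsilon>"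
    let ?B = "{g \<in> extensional I. \<forall>x \<in> S \<inter> I. \<bar>g x - f x\<bar> < \<epsilon>} \<inter> E"
    have "openin (subtopology (powertop_real I) E) ?B"
      using openin_box[of S I] S by (auto simp: openin_subtopology)
    moreover have "f \<in> ?B" using \<open>f \<in> E\<close> E S by auto
    moreover have "f \<in> subtopology (powertop_real I) E closure_of G"
      using L \<open>f \<in> E\<close> topspace_pointwise[OF E] by simp
    ultimately have "\<exists>g. g \<in> G \<and> g \<in> ?B"
      unfolding in_closure_of by (elim conjE allE[of _ ?B]) simp
    then obtain g where "g \<in> G" "g \<in> ?B" by blast
    then show "\<exists>g\<in>G. \<forall>x\<in>S. \<bar>g x - f x\<bar> < \<epsilon>" using S by auto
  qed
next
  assume R: ?R
  have "f \<in> subtopology (powertop_real I) E closure_of G" if fE: "f \<in> E" for f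
    unfolding in_closure_of topspace_pointwise[OF E]
  proof (intro conjI allI impI)
    fix T assume "f \<in> T \<and> openin (subtopology (powertop_real I) E) T"
    then obtain S \<epsilon> where "finite S" "S \<subseteq> I" "0 < \<epsilon>" and
      sub: "\<forall>g\<in>E. (\<forall>x\<in>S. \<bar>g x - f x\<bar> < \<epsilon>) \<longrightarrow> g \<in> T"
      unfolding openin_pointwise_iff[OF E] by blast
    then obtain g where "g \<in> G" "\<forall>x\<in>S. \<bar>g x - f x\<bar> < \<epsilon>"
      using R[rule_format, OF fE, of S \<epsilon>] by blast
    with sub G have "g \<in> T" by (meson subsetD)
    with \<open>g \<in> G\<close> show "\<exists>y. y \<in> G \<and> y \<in> T" by auto
  qed (rule fE)
  then show ?L
    using closure_of_subset_topspace[of "subtopology (powertop_real I) E" G]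
    unfolding topspace_pointwise[OF E] by blast
qed

section \<open>Interpolation in Tychonoff spaces\<close>

lemma Tychonoff_peak:
  assumes X: "Tychonoff_space X" and "finite S" "S \<subseteq> topspace X" "a \<in> topspace X" "a \<notin> S"
  obtains h where "continuous_map X euclideanreal h" "h a = 0" "\<And>x. x \<in> S \<Longrightarrow> h x = 1"
proof -
  have "closedin X S"
    using X assms(2,3) Hausdorff_imp_t1_space t1_space_closedin_finite
    unfolding Tychonoff_space_def by blast
  then obtain h where "continuous_map X (top_of_set {0..1::real}) h" "h a = 0" "h ` S \<subseteq> {1}"
    using X assms(4,5) unfolding Tychonoff_space_def completely_regular_space_def by (metis DiffI)
  then show thesis
    using that[of h] by (auto simp: continuous_map_in_subtopology)
qed

text \<open>A linear combination of peak functions, each equal to \<open>1\<close> at its own point of \<open>S\<close> and \<open>0\<close> at the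
  others. This makes the continuous functions dense in the whole product of lines.\<close>

lemma Tychonoff_interpolation:
  assumes X: "Tychonoff_space X" and S: "finite S" "S \<subseteq> topspace X"
  obtains h where "continuous_map X euclideanreal h" "\<And>x. x \<in> S \<Longrightarrow> h x = v x"
proof -
  have "\<exists>h. continuous_map X euclideanreal h \<and> h a = 0 \<and> (\<forall>x\<in>S - {a}. h x = 1)" if "a \<in> S" for a
  proof -
    have "S - {a} \<subseteq> topspace X" "a \<in> topspace X" using S(2) that by auto
    then obtain h where "continuous_map X euclideanreal h" "h a = 0" "\<And>x. x \<in> S - {a} \<Longrightarrow> h x = 1"
      using Tychonoff_peak[OF X, of "S - {a}" a] S(1) by auto
    then show ?thesis by blast
  qed
  then obtain p where p: "\<And>a. a \<in> S \<Longrightarrow> continuous_map X euclideanreal (p a)"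
    "\<And>a. a \<in> S \<Longrightarrow> p a a = 0" "\<And>a. a \<in> S \<Longrightarrow> \<forall>x\<in>S - {a}. p a x = (1::real)"
    by metis
  let ?h = "\<lambda>x. \<Sum>a\<in>S. v a * (1 - p a x)"
  have "continuous_map X euclideanreal ?h"
    using S p(1) by (intro continuous_intros continuous_map_const[THEN iffD2]) auto
  moreover have "?h x = v x" if "x \<in> S" for x
  proof -
    have "?h x = (\<Sum>a\<in>S. if a = x then v a else 0)"
      using p that by (intro sum.cong) auto
    then show ?thesis using S(1) that by simp
  qed
  ultimately show thesis by (rule that)
qed

text \<open>Clamping an interpolating function to \<open>[-\<delta>, \<delta>]\<close> does not disturb its values on \<open>S\<close>. Thus small
  changes of finitely many values of a continuous function can be made by a change that is small
  uniformly on \<open>X\<close>.\<close>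

lemma Tychonoff_bounded_interpolation:
  assumes X: "Tychonoff_space X" and S: "finite S" "S \<subseteq> topspace X"
    and v: "\<And>x. x \<in> S \<Longrightarrow> \<bar>v x\<bar> \<le> \<delta>" and "0 \<le> \<delta>"
  obtains h where "continuous_map X euclideanreal h" "\<And>x. x \<in> S \<Longrightarrow> h x = v x" "\<And>x. \<bar>h x\<bar> \<le> \<delta>"
proof -
  obtain h where h: "continuous_map X euclideanreal h" "\<And>x. x \<in> S \<Longrightarrow> h x = v x"
    using Tychonoff_interpolation[OF X S] by blast
  show thesis
  proof (rule that[of "\<lambda>x. max (- \<delta>) (min \<delta> (h x))"])
    show "continuous_map X euclideanreal (\<lambda>x. max (- \<delta>) (min \<delta> (h x)))"
      by (intro continuous_intros h continuous_map_const[THEN iffD2]) auto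
    show "max (- \<delta>) (min \<delta> (h x)) = v x" if "x \<in> S" for x
      using h(2)[OF that] v[OF that] by auto
    show "\<bar>max (- \<delta>) (min \<delta> (h x))\<bar> \<le> \<delta>" for x
      using \<open>0 \<le> \<delta>\<close> by auto
  qed
qed

lemma Tychonoff_zero_set_avoiding_countable:
  assumes X: "Tychonoff_space X" and D: "countable D" "D \<subseteq> topspace X"
    and a: "a \<in> topspace X" "a \<notin> D"
  obtains Z where "zero_set X Z" "a \<in> Z" "Z \<inter> D = {}"
proof -
  have "\<exists>Z. zero_set X Z \<and> a \<in> Z \<and> d \<notin> Z" if d: "d \<in> D" for d
  proof -
    obtain h where "continuous_map X euclideanreal h" "h a = 0" "h d = 1"
      using Tychonoff_peak[OF X, of "{d}" a] d D(2) a by auto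
    then show ?thesis using zero_setI[of X h] a(1) by force
  qed
  then obtain Z where Z: "\<And>d. d \<in> D \<Longrightarrow> zero_set X (Z d) \<and> a \<in> Z d \<and> d \<notin> Z d" by metis
  show thesis
  proof (cases "D = {}")
    case True
    then show thesis using that[of "topspace X"] a zero_setI[of X "\<lambda>_. 0"] by simp
  next
    case False
    show thesis
      using Z zero_set_countable_Inter[OF D(1) False, of X Z]
      by (intro that[of "\<Inter>d\<in>D. Z d"]) auto
  qed
qed

section \<open>Step functions that are stably Baire-one\<close>

text \<open>Any choice of constants \<open>q a\<close> on a countable disjoint family of zero-sets \<open>F a\<close> may be added to a
  continuous function, provided that the part of \<open>X\<close> outside all \<open>F a\<close> is the union of zero-sets
  \<open>Z n\<close>. The \<open>n\<close>-th approximating function takes the correct values on the finitely many \<open>F a\<close> with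
  code at most \<open>n\<close> and on \<open>Z 0, \<dots>, Z n\<close>; these are disjoint zero-sets, hence separated by continuous
  functions. Each point lies in one of these sets from some \<open>n\<close> on, which gives stable convergence.\<close>

lemma stable_Baire_one_step_function:
  fixes X :: "'a topology"
  assumes A: "countable A" and disj: "disjoint_family_on F A"
    and F: "\<And>a. a \<in> A \<Longrightarrow> zero_set X (F a)"
    and rest: "Zer_sigma X (topspace X - (\<Union>a\<in>A. F a))"
    and w: "continuous_map X euclideanreal w"
    and f: "f \<in> extensional (topspace X)"
    and f_in: "\<And>a x. a \<in> A \<Longrightarrow> x \<in> F a \<Longrightarrow> f x = w x + q a"
    and f_out: "\<And>x. x \<in> topspace X \<Longrightarrow> x \<notin> (\<Union>a\<in>A. F a) \<Longrightarrow> f x = w x"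
  shows "f \<in> stable_Baire_one X"
proof -
  obtain Z :: "nat \<Rightarrow> 'a set" where Z: "\<And>n. zero_set X (Z n)"
    and restZ: "topspace X - (\<Union>a\<in>A. F a) = (\<Union>n. Z n)"
    using rest unfolding Zer_sigma_def by blast
  define C where "C n = {a \<in> A. to_nat_on A a \<le> n}" for n
  have finC: "finite (C n)" for n
    using finite_vimage_IntI[OF finite_atMost[of n] inj_on_to_nat_on[OF A]]
    unfolding C_def by (simp add: vimage_def Int_def conj_commute)
  define R where "R n a = (\<Union>i\<le>n. Z i) \<union> (\<Union>b\<in>C n - {a}. F b)" for n a
  have "\<exists>h. continuous_map X euclideanreal h \<and> (\<forall>x\<in>F a. h x = 1) \<and> (\<forall>x\<in>R n a. h x = 0)"
    if "a \<in> A" for n a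
  proof -
    have "zero_set X (R n a)"
      unfolding R_def using Z F finC by (intro zero_set_Un zero_set_Union) (auto simp: C_def)
    moreover have "F a \<inter> Z i = {}" for i
      using restZ \<open>a \<in> A\<close> by blast
    then have "F a \<inter> R n a = {}"
      using disj \<open>a \<in> A\<close> unfolding R_def C_def disjoint_family_on_def by blast
    ultimately show ?thesis
      using zero_set_separation[OF F[OF that]] by metis
  qed
  then have "\<exists>h. \<forall>n. \<forall>a\<in>A. continuous_map X euclideanreal (h n a) \<and>
      (\<forall>x\<in>F a. h n a x = 1) \<and> (\<forall>x\<in>R n a. h n a x = 0)"
    by (intro choice allI bchoice ballI)
  then obtain h where h: "\<And>n a. a \<in> A \<Longrightarrow> continuous_map X euclideanreal (h n a)"
    "\<And>n a x. a \<in> A \<Longrightarrow> x \<in> F a \<Longrightarrow> h n a x = (1::real)"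
    "\<And>n a x. a \<in> A \<Longrightarrow> x \<in> R n a \<Longrightarrow> h n a x = 0"
    by blast
  define g where "g n x = w x + (\<Sum>a\<in>C n. q a * h n a x)" for n x
  have "continuous_map X euclideanreal (g n)" for n
    unfolding g_def using finC h(1)
    by (intro continuous_intros w continuous_map_const[THEN iffD2]) (auto simp: C_def)
  moreover have "stably_converges_on (topspace X) g f"
    unfolding stably_converges_on_def
  proof
    fix x assume x: "x \<in> topspace X"
    have "\<exists>N. \<forall>n\<ge>N. g n x = f x"
    proof (cases "x \<in> (\<Union>a\<in>A. F a)")
      case True
      then obtain a where a: "a \<in> A" "x \<in> F a" by blast
      have "g n x = f x" if "n \<ge> to_nat_on A a" for n
      proof -
        have "a \<in> C n" using a that by (simp add: C_def)
        have "(\<Sum>b\<in>C n. q b * h n b x) = (\<Sum>b\<in>C n. if b = a then q a else 0)"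
        proof (rule sum.cong)
          fix b assume "b \<in> C n"
          then have "b \<in> A" by (simp add: C_def)
          show "q b * h n b x = (if b = a then q a else 0)"
          proof (cases "b = a")
            case False
            then have "x \<in> R n b" unfolding R_def using a \<open>a \<in> C n\<close> by blast
            then show ?thesis using h(3)[OF \<open>b \<in> A\<close>] False by simp
          qed (use h(2) a in simp)
        qed simp
        also have "\<dots> = q a" using finC \<open>a \<in> C n\<close> by simp
        finally show ?thesis unfolding g_def using f_in[OF a] by simp
      qed
      then show ?thesis by blast
    next
      case False
      then obtain N where N: "x \<in> Z N" using x restZ by blast
      have "g n x = f x" if "n \<ge> N" for n
      proof -
        have "x \<in> R n b" for b unfolding R_def using N that by blast
        then have "(\<Sum>b\<in>C n. q b * h n b x) = 0"
          using h(3) by (intro sum.neutral) (auto simp: C_def)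
        then show ?thesis unfolding g_def using f_out[OF x False] by simp
      qed
      then show ?thesis by blast
    qed
    then obtain N where "\<forall>n\<ge>N. g n x = f x" ..
    then have "{n. g n x \<noteq> f x} \<subseteq> {..<N}" by (auto simp: not_le[symmetric])
    then show "finite {n. g n x \<noteq> f x}" by (rule finite_subset) simp
  qed
  ultimately show ?thesis
    unfolding stable_Baire_one_def using f by blast
qed

section \<open>Separating zero-sets from a Baire-one function\<close>

lemma open_contains_closed_rational_interval:
  fixes U :: "real set"
  assumes "open U" "y \<in> U"
  obtains p q where "p \<in> \<rat>" "q \<in> \<rat>" "p < y" "y < q" "{p..q} \<subseteq> U"
proof -
  obtain e where e: "e > 0" "ball y e \<subseteq> U"
    using assms by (meson openE)
  obtain p where p: "p \<in> \<rat>" "y - e < p" "p < y"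
    using Rats_dense_in_real[of "y - e" y] e by auto
  obtain q where q: "q \<in> \<rat>" "y < q" "q < y + e"
    using Rats_dense_in_real[of y "y + e"] e by auto
  have "{p..q} \<subseteq> ball y e"
    using p q by (auto simp: dist_real_def)
  then show thesis using that p q e by blast
qed

text \<open>For an open \<open>U\<close>, the limit \<open>f x\<close> lies in \<open>U\<close> if and only if there is a closed rational interval
  inside \<open>U\<close> that contains \<open>g n x\<close> for all large \<open>n\<close>: closedness gives one direction, and an
  interval around \<open>f x\<close> the other. Only countably many intervals and thresholds occur.\<close>

lemma Baire_one_vimage_open:
  assumes f: "f \<in> Baire_one X" and U: "open U"
  shows "Zer_sigma X {x \<in> topspace X. f x \<in> U}"
proof -
  obtain g where g: "\<And>n::nat. continuous_map X euclideanreal (g n)"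
    and lim: "\<And>x. x \<in> topspace X \<Longrightarrow> (\<lambda>n. g n x) \<longlonglongrightarrow> f x"
    using f unfolding Baire_one_def by blast
  define I where "I = {(p, q). p \<in> \<rat> \<and> q \<in> \<rat> \<and> {p..q} \<subseteq> U} \<times> (UNIV :: nat set)"
  define Z where "Z i = (\<Inter>n. {x \<in> topspace X. fst (fst i) \<le> g (snd i + n) x} \<inter>
      {x \<in> topspace X. g (snd i + n) x \<le> snd (fst i)})" for i :: "(real \<times> real) \<times> nat"
  have "countable ((\<rat> \<times> \<rat> :: (real \<times> real) set) \<times> (UNIV :: nat set))"
    by (intro countable_SIGMA countable_rat) auto
  then have "countable I"
    by (rule countable_subset[rotated]) (auto simp: I_def)
  moreover have "zero_set X (Z i)" for i
    unfolding Z_def by (intro zero_set_Inter zero_set_Int zero_set_le zero_set_ge g)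
  ultimately have "Zer_sigma X (\<Union>i\<in>I. Z i)"
    by (intro Zer_sigma_UN_zero_sets)
  moreover have "(\<Union>i\<in>I. Z i) = {x \<in> topspace X. f x \<in> U}"
  proof (intro equalityI subsetI)
    fix x assume "x \<in> (\<Union>i\<in>I. Z i)"
    then obtain p q N where sub: "{p..q} \<subseteq> U" and xZ: "x \<in> Z ((p, q), N)"
      unfolding I_def by blast
    then have x: "x \<in> topspace X" and le: "\<And>n. p \<le> g (N + n) x" "\<And>n. g (N + n) x \<le> q"
      unfolding Z_def by auto
    have "(\<lambda>n. g (N + n) x) \<longlonglongrightarrow> f x"
      using LIMSEQ_ignore_initial_segment[OF lim[OF x], of N] by (simp add: add.commute)
    then have "p \<le> f x" "f x \<le> q"
      using le by (auto intro: LIMSEQ_le_const LIMSEQ_le_const2)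
    then show "x \<in> {x \<in> topspace X. f x \<in> U}" using x sub by auto
  next
    fix x assume "x \<in> {x \<in> topspace X. f x \<in> U}"
    then have x: "x \<in> topspace X" and "f x \<in> U" by auto
    then obtain p q where pq: "p \<in> \<rat>" "q \<in> \<rat>" "p < f x" "f x < q" "{p..q} \<subseteq> U"
      using open_contains_closed_rational_interval[OF U] by blast
    have "\<forall>\<^sub>F n in sequentially. p < g n x \<and> g n x < q"
      using order_tendstoD[OF lim[OF x]] pq by (intro eventually_conj) auto
    then obtain N where "\<And>n. n \<ge> N \<Longrightarrow> p < g n x \<and> g n x < q"
      unfolding eventually_sequentially by blast
    then have "x \<in> Z ((p, q), N)"
      unfolding Z_def using x by (auto intro: less_imp_le)
    then show "x \<in> (\<Union>i\<in>I. Z i)" unfolding I_def using pq by blast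
  qed
  ultimately show ?thesis by simp
qed

text \<open>The property that the theorem requires of the union of a subsequence of the finite sets.\<close>

definition Coz_delta_separated :: "'a topology \<Rightarrow> 'a set \<Rightarrow> bool" where
  "Coz_delta_separated X A \<longleftrightarrow>
     (\<exists>F. disjoint_family_on F A \<and> (\<forall>a\<in>A. zero_set_nbhd X a (F a)) \<and>
       completely_Coz_delta_additive X A F)"

text \<open>The sets \<open>f -` {f a}\<close> would be disjoint and completely \<open>Coz_delta\<close>-additive, since all
  subsets of \<open>f ` A\<close> are closed, but they need not be zero-sets. Hence \<open>f -` {f a}\<close> is replaced by
  the smaller set \<open>Z a\<close> on which every approximating function \<open>g n\<close> has the same value as at \<open>a\<close>.
  Additivity survives: a point outside all \<open>Z b\<close> with \<open>b \<in> B\<close> either has a value outside \<open>f ` B\<close>, or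
  has a value close to some \<open>f b\<close> and misses \<open>Z b\<close>. In the second case it automatically misses the
  other sets \<open>Z c\<close>, whose values are at least \<open>\<delta>\<close> away from \<open>f b\<close>.\<close>

lemma Baire_one_uniformly_separating:
  fixes X :: "'a topology"
  assumes f: "f \<in> Baire_one X" and A: "countable A" "A \<subseteq> topspace X" and "0 < \<delta>"
    and sep: "\<And>a b. a \<in> A \<Longrightarrow> b \<in> A \<Longrightarrow> a \<noteq> b \<Longrightarrow> \<delta> \<le> \<bar>f a - f b\<bar>"
  shows "Coz_delta_separated X A"
proof -
  obtain g where g: "\<And>n::nat. continuous_map X euclideanreal (g n)"
    and lim: "\<And>x. x \<in> topspace X \<Longrightarrow> (\<lambda>n. g n x) \<longlonglongrightarrow> f x"
    using f unfolding Baire_one_def by blast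
  define Z where "Z a = (\<Inter>n. {x \<in> topspace X. g n x - g n a = 0})" for a
  have zero: "zero_set X (Z a)" for a
    unfolding Z_def
    by (intro zero_set_Inter zero_setI continuous_intros g continuous_map_const[THEN iffD2]) auto
  have fZ: "f x = f a" if "a \<in> A" "x \<in> Z a" for a x
  proof -
    have x: "x \<in> topspace X" and "(\<lambda>n. g n x) = (\<lambda>n. g n a)"
      using that(2) unfolding Z_def by auto
    then have "(\<lambda>n. g n a) \<longlonglongrightarrow> f x"
      using lim[OF x] by simp
    moreover have "(\<lambda>n. g n a) \<longlonglongrightarrow> f a"
      using lim A(2) that(1) by blast
    ultimately show ?thesis by (rule LIMSEQ_unique)
  qed
  have "disjoint_family_on Z A"
    unfolding disjoint_family_on_def
  proof (intro ballI impI)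
    fix a b assume ab: "a \<in> A" "b \<in> A" "a \<noteq> b"
    have "f a \<noteq> f b" using sep[OF ab] \<open>0 < \<delta>\<close> by auto
    then show "Z a \<inter> Z b = {}" using fZ[OF ab(1)] fZ[OF ab(2)] by (metis disjoint_iff)
  qed
  moreover have "\<forall>a\<in>A. zero_set_nbhd X a (Z a)"
    unfolding zero_set_nbhd_def using zero A by (auto simp: Z_def)
  moreover have "Coz_delta X (\<Union>b\<in>B. Z b)" if B: "B \<subseteq> A" for B
  proof -
    define V where "V b = {x \<in> topspace X. f x \<in> ball (f b) \<delta>} \<inter> (topspace X - Z b)" for b
    have "closed (f ` B)"
      by (rule discrete_imp_closed[OF \<open>0 < \<delta>\<close>])
         (use sep B in \<open>force simp: dist_real_def\<close>)
    then have "Zer_sigma X {x \<in> topspace X. f x \<in> - (f ` B)}"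
      by (intro Baire_one_vimage_open[OF f]) auto
    moreover have "Zer_sigma X (\<Union>b\<in>B. V b)"
      unfolding V_def using B A(1) zero
      by (intro Zer_sigma_UN Zer_sigma_Int Baire_one_vimage_open[OF f] Zer_sigma_Diff_zero_set)
         (auto intro: countable_subset)
    moreover have "topspace X - (\<Union>b\<in>B. Z b) =
        {x \<in> topspace X. f x \<in> - (f ` B)} \<union> (\<Union>b\<in>B. V b)" (is "?l = ?r")
    proof (intro equalityI subsetI)
      fix x assume l: "x \<in> ?l"
      show "x \<in> ?r"
      proof (cases "f x \<in> f ` B")
        case True
        then obtain b where "b \<in> B" "f x = f b" by blast
        then have "x \<in> V b" using l \<open>0 < \<delta>\<close> by (auto simp: V_def)
        then show ?thesis using \<open>b \<in> B\<close> by blast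
      qed (use l in auto)
    next
      fix x assume "x \<in> ?r"
      then have x: "x \<in> topspace X" by (auto simp: V_def)
      have "x \<notin> Z c" if c: "c \<in> B" for c
      proof
        assume xc: "x \<in> Z c"
        then have fx: "f x = f c" using fZ c B by blast
        then obtain b where b: "b \<in> B" "x \<in> V b" using \<open>x \<in> ?r\<close> c by auto
        then have "\<bar>f b - f c\<bar> < \<delta>" "b \<noteq> c"
          using fx xc by (auto simp: V_def dist_real_def)
        then show False using sep[of b c] b c B by auto
      qed
      then show "x \<in> ?l" using x by blast
    qed
    moreover have "(\<Union>b\<in>B. Z b) \<subseteq> topspace X" by (auto simp: Z_def)
    ultimately show ?thesis
      unfolding Coz_delta_iff_Zer_sigma using Zer_sigma_Un by metis
  qed
  ultimately show ?thesis
    unfolding Coz_delta_separated_def completely_Coz_delta_additive_def by blast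
qed

section \<open>Necessity: a generic function separates a subsequence\<close>

lemma disjoint_family_avoids_finite:
  fixes \<Delta> :: "nat \<Rightarrow> 'a set"
  assumes "disjoint_family \<Delta>" "finite S"
  shows "\<exists>n\<ge>m. \<Delta> n \<inter> S = {}"
proof (rule ccontr)
  assume neg: "\<not> ?thesis"
  define p where "p n = (SOME x. x \<in> \<Delta> n \<inter> S)" for n
  have p: "p n \<in> \<Delta> n \<inter> S" if "n \<ge> m" for n
    unfolding p_def some_in_eq using neg that by blast
  have "inj_on p {m..}"
    using p assms(1) unfolding inj_on_def disjoint_family_on_def by (metis IntD1 IntI UNIV_I atLeast_iff empty_iff)
  moreover have "p ` {m..} \<subseteq> S" using p by auto
  ultimately have "finite {m..}" using assms(2) by (metis finite_imageD finite_subset)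
  then show False using infinite_Ici by blast
qed

lemma stable_Baire_one_subset_Baire_one: "stable_Baire_one X \<subseteq> Baire_one X"
proof
  fix f assume f: "f \<in> stable_Baire_one X"
  then obtain g where g: "\<And>n::nat. continuous_map X euclideanreal (g n)"
    and st: "\<And>x. x \<in> topspace X \<Longrightarrow> finite {n. g n x \<noteq> f x}"
    unfolding stable_Baire_one_def stably_converges_on_def by blast
  have "(\<lambda>n. g n x) \<longlonglongrightarrow> f x" if "x \<in> topspace X" for x
  proof (rule tendsto_eventually)
    show "\<forall>\<^sub>F n in sequentially. g n x = f x"
      using st[OF that] by (simp add: eventually_cofinite flip: cofinite_eq_sequentially)
  qed
  then show "f \<in> Baire_one X"
    using f g unfolding stable_Baire_one_def Baire_one_def by blast
qed

lemma continuous_in_stable_Baire_one: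
  assumes "continuous_map X euclideanreal h"
  shows "restrict h (topspace X) \<in> stable_Baire_one X"
  unfolding stable_Baire_one_def stably_converges_on_def using assms
  by (auto intro!: exI[of _ "\<lambda>_. h"])

text \<open>Give the points of all \<open>\<Delta> n\<close> distinct natural numbers \<open>c\<close>. A box restricts only
  finitely many coordinates and so is disjoint from some late \<open>\<Delta> n\<close>, where a function may still be made
  equal to \<open>c\<close>. Being within \<open>1/3\<close> of \<open>c\<close> on infinitely many \<open>\<Delta> n\<close> is therefore generic, and
  a function with this property takes uniformly separated values on those \<open>\<Delta> n\<close>.\<close>

lemma Baire_imp_Coz_delta_separated_subsequence:
  fixes X :: "'a topology" and \<Delta> :: "nat \<Rightarrow> 'a set"
  assumes X: "Tychonoff_space X"
    and E: "stable_Baire_one X \<subseteq> E" "E \<subseteq> Baire_one X"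
    and Baire: "Baire_space (subtopology (powertop_real (topspace X)) E)"
    and \<Delta>: "\<And>n. finite (\<Delta> n)" "\<And>n. \<Delta> n \<subseteq> topspace X" "disjoint_family \<Delta>"
  shows "\<exists>r :: nat \<Rightarrow> nat. strict_mono r \<and> Coz_delta_separated X (\<Union>k. \<Delta> (r k))"
proof -
  let ?I = "topspace X"
  have ext: "E \<subseteq> extensional ?I" using E(2) unfolding Baire_one_def by blast
  define D where "D = (\<Union>n. \<Delta> n)"
  have "countable D" unfolding D_def using \<Delta>(1) by (simp add: countable_finite)
  define c where "c x = real (to_nat_on D x)" for x
  define G where "G m = {f \<in> E. \<exists>n\<ge>m. \<forall>x\<in>\<Delta> n. \<bar>f x - c x\<bar> < 1/3}" for m :: nat
  have GE: "G m \<subseteq> E" for m unfolding G_def by blast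
  have G_open: "openin (subtopology (powertop_real ?I) E) (G m)" for m
    unfolding openin_pointwise_iff[OF ext]
  proof (intro conjI ballI GE)
    fix f assume "f \<in> G m"
    then obtain n where n: "n \<ge> m" "\<forall>x\<in>\<Delta> n. \<bar>f x - c x\<bar> < 1/3" unfolding G_def by blast
    define e where "e = Min (insert 1 ((\<lambda>x. 1/3 - \<bar>f x - c x\<bar>) ` \<Delta> n))"
    have "e > 0" unfolding e_def using n \<Delta>(1) by simp
    moreover have "g \<in> G m" if g: "g \<in> E" "\<forall>x\<in>\<Delta> n. \<bar>g x - f x\<bar> < e" for g
    proof -
      have "\<bar>g x - c x\<bar> < 1/3" if "x \<in> \<Delta> n" for x
      proof -
        have "e \<le> 1/3 - \<bar>f x - c x\<bar>" unfolding e_def using that \<Delta>(1) by simp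
        moreover have "\<bar>g x - f x\<bar> < e" using g(2) that by blast
        ultimately show ?thesis by linarith
      qed
      then show ?thesis unfolding G_def using g n by blast
    qed
    ultimately show "\<exists>S \<epsilon>. finite S \<and> S \<subseteq> ?I \<and> 0 < \<epsilon> \<and>
        (\<forall>g\<in>E. (\<forall>x\<in>S. \<bar>g x - f x\<bar> < \<epsilon>) \<longrightarrow> g \<in> G m)"
      using \<Delta>(1,2) by (intro exI[of _ "\<Delta> n"] exI[of _ e] conjI) auto
  qed
  have G_dense: "subtopology (powertop_real ?I) E closure_of (G m) =
      topspace (subtopology (powertop_real ?I) E)" for m
    unfolding dense_pointwise_iff[OF ext GE]
  proof (intro ballI allI impI)
    fix f S and \<epsilon> :: real assume "f \<in> E" and S: "finite S \<and> S \<subseteq> ?I \<and> 0 < \<epsilon>"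
    obtain n where n: "n \<ge> m" "\<Delta> n \<inter> S = {}"
      using disjoint_family_avoids_finite[OF \<Delta>(3)] S by blast
    obtain h where h: "continuous_map X euclideanreal h"
      "\<And>x. x \<in> S \<union> \<Delta> n \<Longrightarrow> h x = (if x \<in> S then f x else c x)"
      using Tychonoff_interpolation[OF X, of "S \<union> \<Delta> n" "\<lambda>x. if x \<in> S then f x else c x"] S \<Delta>(1,2)
      by auto
    have hE: "restrict h ?I \<in> E" using continuous_in_stable_Baire_one[OF h(1)] E(1) by blast
    have "\<bar>restrict h ?I x - c x\<bar> < 1/3" if "x \<in> \<Delta> n" for x
    proof -
      have "x \<in> ?I" "x \<notin> S" using that n(2) \<Delta>(2) by auto
      then show ?thesis using h(2)[of x] that by simp
    qed
    then have "restrict h ?I \<in> G m" unfolding G_def using hE n(1) by blast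
    moreover have "\<forall>x\<in>S. \<bar>restrict h ?I x - f x\<bar> < \<epsilon>" using h(2) S by auto
    ultimately show "\<exists>g\<in>G m. \<forall>x\<in>S. \<bar>g x - f x\<bar> < \<epsilon>" by blast
  qed
  have "subtopology (powertop_real ?I) E closure_of (\<Inter>m. G m) =
      topspace (subtopology (powertop_real ?I) E)"
    using Baire G_open G_dense unfolding Baire_space_def by blast
  moreover have "restrict (\<lambda>_. 0) ?I \<in> E"
    using continuous_in_stable_Baire_one[of X "\<lambda>_. 0"] E(1) by auto
  ultimately have "(\<Inter>m. G m) \<noteq> {}"
    using topspace_pointwise[OF ext] by auto
  then obtain f where f: "\<And>m. f \<in> G m" by blast
  define M where "M = {n. \<forall>x\<in>\<Delta> n. \<bar>f x - c x\<bar> < 1/3}"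
  have "infinite M"
    unfolding infinite_nat_iff_unbounded_le M_def using f unfolding G_def by blast
  define A where "A = (\<Union>k. \<Delta> (enumerate M k))"
  have "enumerate M k \<in> M" for k using enumerate_in_set[OF \<open>infinite M\<close>] .
  then have near: "\<bar>f a - c a\<bar> < 1/3" if "a \<in> A" for a
    using that unfolding A_def M_def by blast
  have "A \<subseteq> D" "A \<subseteq> ?I" unfolding A_def D_def using \<Delta>(2) by blast+
  have "1/3 \<le> \<bar>f a - f b\<bar>" if ab: "a \<in> A" "b \<in> A" "a \<noteq> b" for a b
  proof -
    have "to_nat_on D a \<noteq> to_nat_on D b"
      using inj_on_to_nat_on[OF \<open>countable D\<close>] ab \<open>A \<subseteq> D\<close> by (auto dest: inj_onD)
    then have "1 \<le> \<bar>c a - c b\<bar>" unfolding c_def by linarith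
    then show ?thesis using near[OF ab(1)] near[OF ab(2)] by linarith
  qed
  then have "Coz_delta_separated X A"
    using f E(2) \<open>A \<subseteq> D\<close> \<open>A \<subseteq> ?I\<close> \<open>countable D\<close>
    by (intro Baire_one_uniformly_separating[of f _ _ "1/3"]) (auto simp: G_def intro: countable_subset)
  then show ?thesis
    using strict_mono_enumerate[OF \<open>infinite M\<close>] unfolding A_def by blast
qed

section \<open>Prescribing values on a separated set\<close>

text \<open>The function must equal \<open>w\<close> at the points of \<open>D - A\<close>, which may lie in the given zero-sets
  \<open>F a\<close>. So \<open>F a\<close> is first shrunk to its part \<open>F' a\<close> in a zero-set \<open>W a\<close> with \<open>W a \<inter> D = {a}\<close>. The complement
  of the union stays \<open>Zer_sigma\<close>: it grows by the sets \<open>F a - W a\<close>, and here it matters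
  that \<open>F a\<close> is a zero-set and not merely \<open>Coz_delta\<close>.\<close>

lemma Coz_delta_separated_prescribed_values:
  fixes X :: "'a topology"
  assumes X: "Tychonoff_space X" and sep: "Coz_delta_separated X A"
    and D: "countable D" "D \<subseteq> topspace X" and "A \<subseteq> D"
    and w: "continuous_map X euclideanreal w"
  obtains f where "f \<in> stable_Baire_one X"
    "\<And>x. x \<in> D \<Longrightarrow> f x = w x + (if x \<in> A then q x else 0)"
proof -
  obtain F where disjF: "disjoint_family_on F A" and F: "\<And>a. a \<in> A \<Longrightarrow> zero_set X (F a)"
    and aF: "\<And>a. a \<in> A \<Longrightarrow> a \<in> F a" and Coz: "Coz_delta X (\<Union>a\<in>A. F a)"
    using sep unfolding Coz_delta_separated_def completely_Coz_delta_additive_def zero_set_nbhd_def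
    by blast
  have "\<exists>W. zero_set X W \<and> a \<in> W \<and> W \<inter> (D - {a}) = {}" if "a \<in> A" for a
  proof -
    have "countable (D - {a})" "D - {a} \<subseteq> topspace X" "a \<in> topspace X" "a \<notin> D - {a}"
      using D \<open>A \<subseteq> D\<close> that by auto
    from Tychonoff_zero_set_avoiding_countable[OF X this] show ?thesis by metis
  qed
  then have "\<exists>W. \<forall>a\<in>A. zero_set X (W a) \<and> a \<in> W a \<and> W a \<inter> (D - {a}) = {}"
    by (intro bchoice ballI)
  then obtain W where W: "\<And>a. a \<in> A \<Longrightarrow> zero_set X (W a)" "\<And>a. a \<in> A \<Longrightarrow> a \<in> W a"
    "\<And>a. a \<in> A \<Longrightarrow> W a \<inter> (D - {a}) = {}"
    by blast
  define F' where "F' a = F a \<inter> W a" for a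
  have disj: "disjoint_family_on F' A"
    using disjF unfolding disjoint_family_on_def F'_def by blast
  have A: "countable A" using D(1) \<open>A \<subseteq> D\<close> countable_subset by blast
  have "Zer_sigma X ((topspace X - (\<Union>a\<in>A. F a)) \<union> (\<Union>a\<in>A. F a \<inter> (topspace X - W a)))"
  proof (rule Zer_sigma_Un)
    show "Zer_sigma X (topspace X - (\<Union>a\<in>A. F a))"
      using Coz unfolding Coz_delta_iff_Zer_sigma by blast
    show "Zer_sigma X (\<Union>a\<in>A. F a \<inter> (topspace X - W a))"
      using F W(1) A
      by (intro Zer_sigma_UN Zer_sigma_Int Zer_sigma_Diff_zero_set zero_set_imp_Zer_sigma)
  qed
  moreover have "(topspace X - (\<Union>a\<in>A. F a)) \<union> (\<Union>a\<in>A. F a \<inter> (topspace X - W a)) =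
      topspace X - (\<Union>a\<in>A. F' a)"
  proof (intro equalityI subsetI)
    fix x assume x: "x \<in> (topspace X - (\<Union>a\<in>A. F a)) \<union> (\<Union>a\<in>A. F a \<inter> (topspace X - W a))"
    have "x \<notin> F' b" if "b \<in> A" for b
    proof
      assume b: "x \<in> F' b"
      then have "x \<in> (\<Union>a\<in>A. F a)" using that unfolding F'_def by blast
      then obtain a where a: "a \<in> A" "x \<in> F a" "x \<notin> W a"
        using x by auto
      have "a = b" using disjF a that b unfolding disjoint_family_on_def F'_def by blast
      then show False using a b unfolding F'_def by blast
    qed
    then show "x \<in> topspace X - (\<Union>a\<in>A. F' a)" using x by blast
  qed (auto simp: F'_def)
  ultimately have rest: "Zer_sigma X (topspace X - (\<Union>a\<in>A. F' a))" by simp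
  define idx where "idx x = (SOME a. a \<in> A \<and> x \<in> F' a)" for x
  have idx: "idx x = a" if "a \<in> A" "x \<in> F' a" for a x
  proof -
    have "idx x \<in> A \<and> x \<in> F' (idx x)" unfolding idx_def by (rule someI[of _ a]) (use that in blast)
    then show ?thesis using disj that unfolding disjoint_family_on_def by blast
  qed
  define f where "f = restrict (\<lambda>x. w x + (if x \<in> (\<Union>a\<in>A. F' a) then q (idx x) else 0)) (topspace X)"
  show thesis
  proof
    show "f \<in> stable_Baire_one X"
    proof (rule stable_Baire_one_step_function[OF A disj _ rest w])
      show "zero_set X (F' a)" if "a \<in> A" for a
        unfolding F'_def using F W(1) that by (intro zero_set_Int)
      show "f \<in> extensional (topspace X)" unfolding f_def by simp
      show "f x = w x + q a" if "a \<in> A" "x \<in> F' a" for a x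
      proof -
        have "x \<in> topspace X" using that zero_set_subset[OF F[OF that(1)]] unfolding F'_def by auto
        moreover have "x \<in> (\<Union>a\<in>A. F' a)" using that by blast
        ultimately show ?thesis unfolding f_def using idx[OF that] by simp
      qed
      show "f x = w x" if "x \<in> topspace X" "x \<notin> (\<Union>a\<in>A. F' a)" for x
        unfolding f_def using that by simp
    qed
    fix x assume x: "x \<in> D"
    then have xt: "x \<in> topspace X" using D(2) by blast
    show "f x = w x + (if x \<in> A then q x else 0)"
    proof (cases "x \<in> A")
      case True
      then have xF: "x \<in> F' x" unfolding F'_def using aF W(2) by blast
      then have "x \<in> (\<Union>a\<in>A. F' a)" using True by blast
      then show ?thesis unfolding f_def using idx[OF True xF] xt True by simp
    next
      case False
      then have "x \<notin> (\<Union>a\<in>A. F' a)" using W(3) x unfolding F'_def by blast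
      then show ?thesis unfolding f_def using xt False by simp
    qed
  qed
qed

section \<open>Fusion of finite specifications\<close>

text \<open>What is used of a dense open subset of the function space \<open>E\<close>: every finite specification of values
  \<open>c\<close> on \<open>S\<close>, up to an error \<open>\<delta>\<close>, has a finite refinement all of whose realisations in \<open>E\<close> are in
  \<open>G\<close>.\<close>

definition box_dense :: "'a topology \<Rightarrow> ('a \<Rightarrow> real) set \<Rightarrow> ('a \<Rightarrow> real) set \<Rightarrow> bool" where
  "box_dense X E G \<longleftrightarrow> (\<forall>S c \<delta>. finite S \<and> S \<subseteq> topspace X \<and> (0::real) < \<delta> \<longrightarrow>
    (\<exists>S' c' \<epsilon>. finite S' \<and> S \<subseteq> S' \<and> S' \<subseteq> topspace X \<and> 0 < \<epsilon> \<and>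
      (\<forall>x\<in>S. \<bar>c' x - c x\<bar> < \<delta>) \<and> (\<forall>f\<in>E. (\<forall>x\<in>S'. \<bar>f x - c' x\<bar> < \<epsilon>) \<longrightarrow> f \<in> G)))"

lemma box_dense_if_open_dense:
  assumes X: "Tychonoff_space X" and E: "stable_Baire_one X \<subseteq> E" "E \<subseteq> extensional (topspace X)"
    and op: "openin (subtopology (powertop_real (topspace X)) E) G"
    and dense: "subtopology (powertop_real (topspace X)) E closure_of G =
      topspace (subtopology (powertop_real (topspace X)) E)"
  shows "box_dense X E G"
  unfolding box_dense_def
proof (intro allI impI)
  fix S c and \<delta> :: real assume S: "finite S \<and> S \<subseteq> topspace X \<and> 0 < \<delta>"
  have G: "G \<subseteq> E" using op openin_pointwise_iff[OF E(2)] by blast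
  obtain h where h: "continuous_map X euclideanreal h" "\<And>x. x \<in> S \<Longrightarrow> h x = c x"
    using Tychonoff_interpolation[OF X, of S c] S by blast
  have "restrict h (topspace X) \<in> E" using continuous_in_stable_Baire_one[OF h(1)] E(1) by blast
  then obtain g where g: "g \<in> G" "\<forall>x\<in>S. \<bar>g x - restrict h (topspace X) x\<bar> < \<delta>"
    using dense S unfolding dense_pointwise_iff[OF E(2) G] by blast
  obtain S1 \<epsilon> where S1: "finite S1" "S1 \<subseteq> topspace X" "0 < \<epsilon>"
    "\<forall>f\<in>E. (\<forall>x\<in>S1. \<bar>f x - g x\<bar> < \<epsilon>) \<longrightarrow> f \<in> G"
    using op g(1) unfolding openin_pointwise_iff[OF E(2)] by meson
  have "\<forall>x\<in>S. \<bar>g x - c x\<bar> < \<delta>"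
  proof
    fix x assume "x \<in> S"
    then show "\<bar>g x - c x\<bar> < \<delta>" using g(2) h(2)[of x] S by (auto simp: subset_iff)
  qed
  then show "\<exists>S' c' \<epsilon>. finite S' \<and> S \<subseteq> S' \<and> S' \<subseteq> topspace X \<and> 0 < \<epsilon> \<and>
      (\<forall>x\<in>S. \<bar>c' x - c x\<bar> < \<delta>) \<and> (\<forall>f\<in>E. (\<forall>x\<in>S'. \<bar>f x - c' x\<bar> < \<epsilon>) \<longrightarrow> f \<in> G)"
    using S S1 by (intro exI[of _ "S \<union> S1"] exI[of _ g] exI[of _ \<epsilon>] conjI) auto
qed

text \<open>To get \<open>w + t\<close> on \<open>S\<close> into \<open>G\<close> its values have to change slightly. The change is charged to the
  continuous function \<open>w\<close>, by a uniformly small amount, so that the increments \<open>t\<close> stay exactly as they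
  are; new increments \<open>t'\<close> are introduced only on the new points \<open>S' - S\<close>.\<close>

lemma box_dense_absorb:
  assumes X: "Tychonoff_space X" and G: "box_dense X E G"
    and w: "continuous_map X euclideanreal w" and S: "finite S" "S \<subseteq> topspace X" and "0 < \<delta>"
  obtains w' S' t' \<epsilon> where "continuous_map X euclideanreal w'" "\<And>x. \<bar>w' x - w x\<bar> \<le> \<delta>"
    "finite S'" "S \<subseteq> S'" "S' \<subseteq> topspace X" "0 < (\<epsilon>::real)" "\<And>x. x \<in> S \<Longrightarrow> t' x = t x"
    "\<forall>f\<in>E. (\<forall>x\<in>S'. \<bar>f x - (w' x + t' x)\<bar> < \<epsilon>) \<longrightarrow> f \<in> G"
proof -
  obtain S' c' \<epsilon> where S': "finite S'" "S \<subseteq> S'" "S' \<subseteq> topspace X" "0 < \<epsilon>"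
    and c': "\<forall>x\<in>S. \<bar>c' x - (w x + t x)\<bar> < \<delta>"
    and in_G: "\<forall>f\<in>E. (\<forall>x\<in>S'. \<bar>f x - c' x\<bar> < \<epsilon>) \<longrightarrow> f \<in> G"
    using G[unfolded box_dense_def, rule_format, of S \<delta> "\<lambda>x. w x + t x"] S \<open>0 < \<delta>\<close> by metis
  obtain h where h: "continuous_map X euclideanreal h"
    "\<And>x. x \<in> S \<Longrightarrow> h x = c' x - (w x + t x)" "\<And>x. \<bar>h x\<bar> \<le> \<delta>"
    using Tychonoff_bounded_interpolation[OF X S, of "\<lambda>x. c' x - (w x + t x)" \<delta>] c' \<open>0 < \<delta>\<close>
    by (metis less_imp_le)
  define t' where "t' x = (if x \<in> S then t x else c' x - (w x + h x))" for x
  have eq: "w x + h x + t' x = c' x" for x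
    unfolding t'_def using h(2)[of x] by auto
  show thesis
  proof (rule that[of "\<lambda>x. w x + h x" S' \<epsilon> t'])
    show "continuous_map X euclideanreal (\<lambda>x. w x + h x)" by (intro continuous_intros w h)
    show "\<forall>f\<in>E. (\<forall>x\<in>S'. \<bar>f x - (w x + h x + t' x)\<bar> < \<epsilon>) \<longrightarrow> f \<in> G"
      unfolding eq by (rule in_G)
  qed (use S' h(3) in \<open>auto simp: t'_def\<close>)
qed

text \<open>Treats finitely many pairs of a set \<open>G j\<close> and increments \<open>t j\<close> on \<open>S\<close>, with the same increments \<open>q\<close>
  on the new points for all of them. The pairs are handled one after another; each correction of \<open>w\<close> is
  at most half of the tolerance left by the previous ones, so it does not undo what they achieved.\<close>

lemma box_dense_absorb_finite:
  assumes X: "Tychonoff_space X" and "finite J" and G: "\<And>j. j \<in> J \<Longrightarrow> box_dense X E (G j)"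
    and w: "continuous_map X euclideanreal w" and S: "finite S" "S \<subseteq> topspace X" and "0 < \<delta>"
  shows "\<exists>w' S' q \<epsilon>. continuous_map X euclideanreal w' \<and> (\<forall>x. \<bar>w' x - w x\<bar> \<le> \<delta>) \<and>
    finite S' \<and> S \<subseteq> S' \<and> S' \<subseteq> topspace X \<and> 0 < (\<epsilon>::real) \<and>
    (\<forall>j\<in>J. \<forall>f\<in>E. (\<forall>x\<in>S. \<bar>f x - (w' x + t j x)\<bar> < \<epsilon>) \<longrightarrow>
      (\<forall>x\<in>S' - S. \<bar>f x - (w' x + q x)\<bar> < \<epsilon>) \<longrightarrow> f \<in> G j)"
  using \<open>finite J\<close> G \<open>0 < \<delta>\<close>
proof (induction J arbitrary: \<delta> rule: finite_induct)
  case empty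
  then show ?case
    using w S by (intro exI[of _ w] exI[of _ S] exI[of _ "\<lambda>_. 0"] exI[of _ 1]) auto
next
  case (insert j J)
  have "0 < \<delta> / 2" using insert.prems by simp
  then obtain w1 S1 q1 \<epsilon>1 where w1: "continuous_map X euclideanreal w1"
    and w1_near: "\<forall>x. \<bar>w1 x - w x\<bar> \<le> \<delta> / 2"
    and S1: "finite S1" "S \<subseteq> S1" "S1 \<subseteq> topspace X" and "0 < \<epsilon>1"
    and in1: "\<forall>j\<in>J. \<forall>f\<in>E. (\<forall>x\<in>S. \<bar>f x - (w1 x + t j x)\<bar> < \<epsilon>1) \<longrightarrow>
      (\<forall>x\<in>S1 - S. \<bar>f x - (w1 x + q1 x)\<bar> < \<epsilon>1) \<longrightarrow> f \<in> G j"
    using insert.IH[of "\<delta> / 2"] insert.prems(1) by auto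
  have pos: "0 < min (\<delta> / 2) (\<epsilon>1 / 2)" using insert.prems(2) \<open>0 < \<epsilon>1\<close> by simp
  obtain w2 S2 \<epsilon>2 q2 where w2: "continuous_map X euclideanreal w2"
    and w2_near: "\<And>x. \<bar>w2 x - w1 x\<bar> \<le> min (\<delta> / 2) (\<epsilon>1 / 2)"
    and S2: "finite S2" "S1 \<subseteq> S2" "S2 \<subseteq> topspace X" and "0 < \<epsilon>2"
    and q2: "\<And>x. x \<in> S1 \<Longrightarrow> q2 x = (if x \<in> S then t j x else q1 x)"
    and in2: "\<forall>f\<in>E. (\<forall>x\<in>S2. \<bar>f x - (w2 x + q2 x)\<bar> < \<epsilon>2) \<longrightarrow> f \<in> G j"
    by (rule box_dense_absorb[OF X insert.prems(1)[OF insertI1] w1 S1(1,3) pos,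
          where t = "\<lambda>x. if x \<in> S then t j x else q1 x"]) (rule that)
  define \<epsilon> where "\<epsilon> = min (\<epsilon>1 / 2) \<epsilon>2"
  have "f \<in> G i" if i: "i \<in> insert j J" and f: "f \<in> E"
    and near_S: "\<forall>x\<in>S. \<bar>f x - (w2 x + t i x)\<bar> < \<epsilon>"
    and near_new: "\<forall>x\<in>S2 - S. \<bar>f x - (w2 x + q2 x)\<bar> < \<epsilon>" for i f
  proof (cases "i = j")
    case True
    have "\<bar>f x - (w2 x + q2 x)\<bar> < \<epsilon>2" if "x \<in> S2" for x
    proof (cases "x \<in> S")
      case x: True
      then have "q2 x = t i x" using q2 S1(2) True by auto
      then show ?thesis using near_S x unfolding \<epsilon>_def by simp
    next
      case False
      then show ?thesis using near_new that unfolding \<epsilon>_def by simp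
    qed
    then show ?thesis using in2 f True by blast
  next
    case False
    have move: "\<bar>f x - (w1 x + c)\<bar> < \<epsilon>1" if "\<bar>f x - (w2 x + c)\<bar> < \<epsilon>" for x c
      using w2_near[of x] that unfolding \<epsilon>_def by linarith
    have "\<forall>x\<in>S. \<bar>f x - (w1 x + t i x)\<bar> < \<epsilon>1" using near_S move by blast
    moreover have "\<forall>x\<in>S1 - S. \<bar>f x - (w1 x + q1 x)\<bar> < \<epsilon>1"
    proof
      fix x assume x: "x \<in> S1 - S"
      then have "q2 x = q1 x" "x \<in> S2 - S" using q2[of x] S2(2) by auto
      then have "\<bar>f x - (w2 x + q1 x)\<bar> < \<epsilon>" using near_new by metis
      then show "\<bar>f x - (w1 x + q1 x)\<bar> < \<epsilon>1" by (rule move)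
    qed
    ultimately show ?thesis using in1 i f False by blast
  qed
  moreover have "\<bar>w2 x - w x\<bar> \<le> \<delta>" for x
    using w2_near[of x] w1_near[rule_format, of x] by linarith
  moreover have "0 < \<epsilon>" unfolding \<epsilon>_def using \<open>0 < \<epsilon>1\<close> \<open>0 < \<epsilon>2\<close> by simp
  ultimately show ?case
    using w2 S2 S1(2) by (intro exI[of _ w2] exI[of _ S2] exI[of _ q2] exI[of _ \<epsilon>]) auto
qed

text \<open>At stage \<open>n\<close> the finitely many increments considered are those that equal \<open>q\<close> on an arbitrary
  subset \<open>B\<close> of \<open>S n\<close> and vanish on the rest. Thus a function that equals \<open>w + q\<close> on the new points
  \<open>S (Suc n) - S n\<close> is in \<open>G 0, \<dots>, G n\<close>, whichever of \<open>w\<close> and \<open>w + q\<close> it equals at each earlier point. A bound \<open>\<delta> n\<close>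
  that is at least halved at each stage controls all later changes of \<open>w\<close>, which
  is obtained as a uniform limit.\<close>

lemma generic_fusion:
  fixes X :: "'a topology" and G :: "nat \<Rightarrow> ('a \<Rightarrow> real) set"
  assumes X: "Tychonoff_space X" and G: "\<And>i. box_dense X E (G i)"
    and w0: "continuous_map X euclideanreal w0" and S0: "finite S0" "S0 \<subseteq> topspace X"
    and "0 < \<delta>0"
  obtains w and S :: "nat \<Rightarrow> 'a set" and q where "continuous_map X euclideanreal w"
    "\<And>x. x \<in> topspace X \<Longrightarrow> \<bar>w x - w0 x\<bar> \<le> \<delta>0"
    "S 0 = S0" "mono S" "\<And>n. finite (S n)" "\<And>n. S n \<subseteq> topspace X"
    "\<forall>n. \<forall>i\<le>n. \<forall>B\<subseteq>S n. \<forall>f\<in>E. (\<forall>x\<in>S n. f x = w x + (if x \<in> B then q x else 0)) \<longrightarrow>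
       (\<forall>x\<in>S (Suc n) - S n. f x = w x + q x) \<longrightarrow> f \<in> G i"
proof -
  define P :: "nat \<Rightarrow> ('a \<Rightarrow> real) \<times> real \<times> 'a set \<times> ('a \<Rightarrow> real) \<Rightarrow> bool" where
    "P n = (\<lambda>(w, \<delta>, S, q). continuous_map X euclideanreal w \<and> 0 < \<delta> \<and> finite S \<and> S \<subseteq> topspace X \<and>
       (n = 0 \<longrightarrow> w = w0 \<and> \<delta> = \<delta>0 \<and> S = S0))" for n
  define Q :: "nat \<Rightarrow> ('a \<Rightarrow> real) \<times> real \<times> 'a set \<times> ('a \<Rightarrow> real) \<Rightarrow>
      ('a \<Rightarrow> real) \<times> real \<times> 'a set \<times> ('a \<Rightarrow> real) \<Rightarrow> bool" where
    "Q n = (\<lambda>(w, \<delta>, S, q) (w', \<delta>', S', q'). (\<forall>x. \<bar>w' x - w x\<bar> \<le> \<delta> / 2) \<and> \<delta>' \<le> \<delta> / 2 \<and> S \<subseteq> S' \<and>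
       (\<forall>x\<in>S. q' x = q x) \<and>
       (\<forall>i\<le>n. \<forall>B\<subseteq>S. \<forall>f\<in>E. (\<forall>x\<in>S. \<bar>f x - (w' x + (if x \<in> B then q x else 0))\<bar> \<le> \<delta>') \<longrightarrow>
          (\<forall>x\<in>S' - S. \<bar>f x - (w' x + q' x)\<bar> \<le> \<delta>') \<longrightarrow> f \<in> G i))" for n
  have step: "\<exists>s'. P (Suc n) s' \<and> Q n s s'" if "P n s" for n s
  proof -
    obtain w \<delta> S q where s: "s = (w, \<delta>, S, q)" by (cases s)
    with that have w: "continuous_map X euclideanreal w" and "0 < \<delta>"
      and S: "finite S" "S \<subseteq> topspace X"
      unfolding P_def by auto
    have "finite ({..n} \<times> Pow S)" using S by simp
    moreover have "box_dense X E (G (fst j))" for j :: "nat \<times> 'a set" by (rule G)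
    moreover have "0 < \<delta> / 2" using \<open>0 < \<delta>\<close> by simp
    ultimately have "\<exists>w' S' q' \<epsilon>. continuous_map X euclideanreal w' \<and>
        (\<forall>x. \<bar>w' x - w x\<bar> \<le> \<delta> / 2) \<and> finite S' \<and> S \<subseteq> S' \<and> S' \<subseteq> topspace X \<and> 0 < \<epsilon> \<and>
        (\<forall>j\<in>{..n} \<times> Pow S. \<forall>f\<in>E.
          (\<forall>x\<in>S. \<bar>f x - (w' x + (if x \<in> snd j then q x else 0))\<bar> < \<epsilon>) \<longrightarrow>
          (\<forall>x\<in>S' - S. \<bar>f x - (w' x + q' x)\<bar> < \<epsilon>) \<longrightarrow> f \<in> G (fst j))"
      by (intro box_dense_absorb_finite[OF X _ _ w S])
    then obtain w' S' q' \<epsilon> where w': "continuous_map X euclideanreal w'"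
      "\<forall>x. \<bar>w' x - w x\<bar> \<le> \<delta> / 2"
      and S': "finite S'" "S \<subseteq> S'" "S' \<subseteq> topspace X" and "0 < \<epsilon>"
      and in_G: "\<forall>j\<in>{..n} \<times> Pow S. \<forall>f\<in>E.
        (\<forall>x\<in>S. \<bar>f x - (w' x + (if x \<in> snd j then q x else 0))\<bar> < \<epsilon>) \<longrightarrow>
        (\<forall>x\<in>S' - S. \<bar>f x - (w' x + q' x)\<bar> < \<epsilon>) \<longrightarrow> f \<in> G (fst j)"
      by (elim exE conjE) (rule that)
    \<comment> \<open>Half of \<open>\<epsilon>\<close>, since the limit \<open>w\<close> will satisfy only a non-strict bound.\<close>
    define \<delta>' where "\<delta>' = min (\<delta> / 2) (\<epsilon> / 2)"
    define q'' where "q'' x = (if x \<in> S then q x else q' x)" for x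
    have "\<delta>' < \<epsilon>" unfolding \<delta>'_def using \<open>0 < \<epsilon>\<close> by auto
    have "f \<in> G i" if "i \<le> n" "B \<subseteq> S" "f \<in> E"
      and 1: "\<forall>x\<in>S. \<bar>f x - (w' x + (if x \<in> B then q x else 0))\<bar> \<le> \<delta>'"
      and 2: "\<forall>x\<in>S' - S. \<bar>f x - (w' x + q'' x)\<bar> \<le> \<delta>'" for i B f
    proof -
      have "\<forall>x\<in>S. \<bar>f x - (w' x + (if x \<in> B then q x else 0))\<bar> < \<epsilon>"
        using 1 \<open>\<delta>' < \<epsilon>\<close> by (meson le_less_trans)
      moreover have "\<forall>x\<in>S' - S. \<bar>f x - (w' x + q' x)\<bar> < \<epsilon>"
      proof
        fix x assume x: "x \<in> S' - S"
        then have "\<bar>f x - (w' x + q'' x)\<bar> < \<epsilon>" using 2 \<open>\<delta>' < \<epsilon>\<close> by (meson le_less_trans)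
        then show "\<bar>f x - (w' x + q' x)\<bar> < \<epsilon>" using x unfolding q''_def by simp
      qed
      moreover have "(i, B) \<in> {..n} \<times> Pow S" using that by simp
      ultimately show ?thesis using in_G[rule_format, of "(i, B)" f] \<open>f \<in> E\<close> by simp
    qed
    then have "Q n s (w', \<delta>', S', q'')"
      unfolding Q_def s using w' S' by (auto simp: \<delta>'_def q''_def)
    moreover have "P (Suc n) (w', \<delta>', S', q'')"
      unfolding P_def using w' S' \<open>0 < \<epsilon>\<close> \<open>0 < \<delta>\<close> by (auto simp: \<delta>'_def)
    ultimately show ?thesis by blast
  qed
  have "\<exists>s. P 0 s"
    unfolding P_def using w0 S0 \<open>0 < \<delta>0\<close> by (intro exI[of _ "(w0, \<delta>0, S0, \<lambda>_. 0)"]) simp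
  from dependent_nat_choice[of P Q, OF this step] obtain s
    where s: "\<And>n. P n (s n)" "\<And>n. Q n (s n) (s (Suc n))" by blast
  define W where "W n = fst (s n)" for n
  define \<delta> where "\<delta> n = fst (snd (s n))" for n
  define S where "S n = fst (snd (snd (s n)))" for n
  define qs where "qs n = snd (snd (snd (s n)))" for n
  have s_eq: "s n = (W n, \<delta> n, S n, qs n)" for n
    unfolding W_def \<delta>_def S_def qs_def by simp
  have W: "continuous_map X euclideanreal (W n)" and \<delta>: "0 < \<delta> n"
    and S: "finite (S n)" "S n \<subseteq> topspace X" for n
    using s(1)[of n] unfolding P_def s_eq by auto
  have W0: "W 0 = w0" "\<delta> 0 = \<delta>0" "S 0 = S0"
    using s(1)[of 0] unfolding P_def s_eq by auto
  have W_step: "\<bar>W (Suc n) x - W n x\<bar> \<le> \<delta> n / 2" and \<delta>_step: "\<delta> (Suc n) \<le> \<delta> n / 2"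
    and S_step: "S n \<subseteq> S (Suc n)" and qs_step: "x \<in> S n \<Longrightarrow> qs (Suc n) x = qs n x" for n x
    using s(2)[of n] unfolding Q_def s_eq by auto
  have in_G: "f \<in> G i" if "i \<le> n" "B \<subseteq> S n" "f \<in> E"
    "\<And>x. x \<in> S n \<Longrightarrow> \<bar>f x - (W (Suc n) x + (if x \<in> B then qs n x else 0))\<bar> \<le> \<delta> (Suc n)"
    "\<And>x. x \<in> S (Suc n) - S n \<Longrightarrow> \<bar>f x - (W (Suc n) x + qs (Suc n) x)\<bar> \<le> \<delta> (Suc n)" for i n B f
    using s(2)[of n] that unfolding Q_def s_eq by simp
  have "mono S" using S_step by (rule incseq_SucI)
  \<comment> \<open>Since \<open>\<delta> n / 2 \<le> \<delta> n - \<delta> (Suc n)\<close>, the bounds on the steps telescope.\<close>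
  have W_diff: "\<bar>W m x - W n x\<bar> \<le> \<delta> n - \<delta> m" if "n \<le> m" for m n x
    using that
  proof (induction m rule: dec_induct)
    case (step m)
    then show ?case using W_step[of m x] \<delta>_step[of m] by linarith
  qed simp
  have "\<delta> n \<le> \<delta>0 * (1/2) ^ n" for n
  proof (induction n)
    case (Suc n)
    then show ?case using \<delta>_step[of n] by simp
  qed (simp add: W0)
  moreover have "(\<lambda>n. \<delta>0 * (1/2) ^ n) \<longlonglongrightarrow> 0"
    by (intro tendsto_mult_right_zero LIMSEQ_power_zero) simp
  ultimately have \<delta>_lim: "\<delta> \<longlonglongrightarrow> 0"
    by (intro tendsto_sandwich[OF _ _ tendsto_const, of 0 \<delta> sequentially "\<lambda>n. \<delta>0 * (1/2) ^ n"])
       (use less_imp_le[OF \<delta>] in auto)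
  have small: "\<exists>N. \<forall>n\<ge>N. \<delta> n < e" if "0 < e" for e
    using order_tendstoD(2)[OF \<delta>_lim that] unfolding eventually_sequentially .
  have "convergent (\<lambda>n. W n x)" for x
  proof (rule real_Cauchy_convergent, rule CauchyI')
    fix e :: real assume "0 < e"
    then obtain N where N: "\<forall>n\<ge>N. \<delta> n < e" using small by blast
    show "\<exists>N. \<forall>m\<ge>N. \<forall>n>m. dist (W m x) (W n x) < e"
    proof (intro exI allI impI)
      fix m n assume "N \<le> m" "m < n"
      then have "\<bar>W n x - W m x\<bar> \<le> \<delta> m - \<delta> n" "\<delta> m < e"
        using W_diff N by auto
      then show "dist (W m x) (W n x) < e"
        using \<delta>[of n] unfolding dist_real_def by linarith
    qed
  qed
  then obtain w where lim: "\<And>x. (\<lambda>n. W n x) \<longlonglongrightarrow> w x"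
    unfolding convergent_def by metis
  have w_near: "\<bar>w x - W n x\<bar> \<le> \<delta> n" for n x
  proof (rule tendsto_upperbound)
    show "(\<lambda>m. \<bar>W m x - W n x\<bar>) \<longlonglongrightarrow> \<bar>w x - W n x\<bar>" by (intro tendsto_intros lim)
    show "\<forall>\<^sub>F m in sequentially. \<bar>W m x - W n x\<bar> \<le> \<delta> n"
      using eventually_ge_at_top[of n]
    proof eventually_elim
      case (elim m)
      then show ?case using W_diff[of n m x] \<delta>[of m] by linarith
    qed
  qed simp
  have "uniform_limit (topspace X) W w sequentially"
    unfolding uniform_limit_iff
  proof (intro allI impI)
    fix e :: real assume "0 < e"
    from order_tendstoD(2)[OF \<delta>_lim this]
    show "\<forall>\<^sub>F n in sequentially. \<forall>x\<in>topspace X. dist (W n x) (w x) < e"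
    proof eventually_elim
      case (elim n)
      then show ?case using w_near[of _ n] by (auto simp: dist_real_def abs_minus_commute intro: le_less_trans)
    qed
  qed
  then have w: "continuous_map X euclideanreal w"
    using uniform_limit_continuous_map_real[of X W w] W by simp
  \<comment> \<open>Increments never change once chosen, so the first stage that contains \<open>x\<close> determines them.\<close>
  define q where "q x = qs (LEAST n. x \<in> S n) x" for x
  have qs_stable: "qs n x = qs m x" if "m \<le> n" "x \<in> S m" for m n x
    using that(1)
  proof (induction n rule: dec_induct)
    case (step n)
    then have "x \<in> S n" using that(2) monoD[OF \<open>mono S\<close> step.hyps(1)] by blast
    then show ?case using step.IH qs_step by simp
  qed simp
  have q: "q x = qs n x" if "x \<in> S n" for x n
    unfolding q_def using qs_stable[of "LEAST n. x \<in> S n" n x]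
      Least_le[of "\<lambda>n. x \<in> S n", OF that] LeastI[of "\<lambda>n. x \<in> S n", OF that] by simp
  show thesis
  proof
    show "continuous_map X euclideanreal w" by (rule w)
    show "\<bar>w x - w0 x\<bar> \<le> \<delta>0" for x using w_near[of x 0] W0 by simp
    show "\<forall>n. \<forall>i\<le>n. \<forall>B\<subseteq>S n. \<forall>f\<in>E. (\<forall>x\<in>S n. f x = w x + (if x \<in> B then q x else 0)) \<longrightarrow>
       (\<forall>x\<in>S (Suc n) - S n. f x = w x + q x) \<longrightarrow> f \<in> G i"
    proof (intro allI ballI impI)
      fix n i B f assume "i \<le> n" "B \<subseteq> S n" "f \<in> E"
        and old: "\<forall>x\<in>S n. f x = w x + (if x \<in> B then q x else 0)"
        and new: "\<forall>x\<in>S (Suc n) - S n. f x = w x + q x"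
      show "f \<in> G i"
      proof (rule in_G[OF \<open>i \<le> n\<close> \<open>B \<subseteq> S n\<close> \<open>f \<in> E\<close>])
      show "\<bar>f x - (W (Suc n) x + (if x \<in> B then qs n x else 0))\<bar> \<le> \<delta> (Suc n)" if "x \<in> S n" for x
        using old w_near[of x "Suc n"] q[OF that] that by simp
      show "\<bar>f x - (W (Suc n) x + qs (Suc n) x)\<bar> \<le> \<delta> (Suc n)" if "x \<in> S (Suc n) - S n" for x
        using new w_near[of x "Suc n"] q[of x "Suc n"] that by simp
      qed
    qed
  qed (use W0 S \<open>mono S\<close> in auto)
qed

section \<open>Sufficiency, and the equivalence\<close>

lemma Coz_delta_separated_empty: "Coz_delta_separated X {}"
proof -
  have "Coz_delta X {}"
    unfolding Coz_delta_iff_Zer_sigma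
    using Zer_sigma_Diff_zero_set[OF zero_set_empty, of X] by simp
  then show ?thesis
    unfolding Coz_delta_separated_def completely_Coz_delta_additive_def disjoint_family_on_def by simp
qed

text \<open>Apply the fusion construction to dense open sets \<open>G i\<close> and put \<open>\<Delta> n = S (Suc n) - S n\<close>. If \<open>A\<close>
  contains \<open>\<Delta> n\<close> for infinitely many \<open>n\<close>, then every function in \<open>E\<close> equal to \<open>w + q\<close> on \<open>A\<close> and to \<open>w\<close>
  on the rest of \<open>\<Union>n. S n\<close> belongs to all \<open>G i\<close>. The hypothesis supplies such an \<open>A\<close> for which the
  function exists.\<close>

lemma Baire_if_Coz_delta_separated_subsequences:
  fixes X :: "'a topology"
  assumes X: "Tychonoff_space X"
    and E: "stable_Baire_one X \<subseteq> E" "E \<subseteq> extensional (topspace X)"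
    and sep: "\<And>\<Delta> :: nat \<Rightarrow> 'a set. (\<And>n. \<Delta> n \<noteq> {}) \<Longrightarrow> (\<And>n. finite (\<Delta> n)) \<Longrightarrow>
      (\<And>n. \<Delta> n \<subseteq> topspace X) \<Longrightarrow> disjoint_family \<Delta> \<Longrightarrow>
      \<exists>r :: nat \<Rightarrow> nat. strict_mono r \<and> Coz_delta_separated X (\<Union>k. \<Delta> (r k))"
  shows "Baire_space (subtopology (powertop_real (topspace X)) E)"
  unfolding Baire_space_def
proof (intro allI impI)
  fix G :: "nat \<Rightarrow> ('a \<Rightarrow> real) set"
  assume G: "\<forall>n. openin (subtopology (powertop_real (topspace X)) E) (G n) \<and>
    subtopology (powertop_real (topspace X)) E closure_of G n =
    topspace (subtopology (powertop_real (topspace X)) E)"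
  have box: "box_dense X E (G n)" for n
    using box_dense_if_open_dense[OF X E] G by blast
  have "(\<Inter>n. G n) \<subseteq> E"
    using G openin_pointwise_iff[OF E(2)] by blast
  have "\<exists>g\<in>\<Inter>n. G n. \<forall>x\<in>S0. \<bar>g x - f0 x\<bar> < \<epsilon>"
    if S0: "finite S0" "S0 \<subseteq> topspace X" and "0 < \<epsilon>" for f0 :: "'a \<Rightarrow> real" and S0 and \<epsilon> :: real
  proof -
    obtain w0 where w0: "continuous_map X euclideanreal w0" "\<And>x. x \<in> S0 \<Longrightarrow> w0 x = f0 x"
      using Tychonoff_interpolation[OF X S0] by blast
    have "0 < \<epsilon> / 2" using \<open>0 < \<epsilon>\<close> by simp
    obtain w S q where w: "continuous_map X euclideanreal w"
      and w_near: "\<And>x. x \<in> topspace X \<Longrightarrow> \<bar>w x - w0 x\<bar> \<le> \<epsilon> / 2"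
      and S: "S 0 = S0" "mono S" "\<And>n. finite (S n)" "\<And>n. S n \<subseteq> topspace X"
      and in_G: "\<forall>n. \<forall>i\<le>n. \<forall>B\<subseteq>S n. \<forall>f\<in>E. (\<forall>x\<in>S n. f x = w x + (if x \<in> B then q x else 0)) \<longrightarrow>
         (\<forall>x\<in>S (Suc n) - S n. f x = w x + q x) \<longrightarrow> f \<in> G i"
      by (rule generic_fusion[OF X box w0(1) S0 \<open>0 < \<epsilon> / 2\<close>]) (rule that)
    define \<Delta> where "\<Delta> n = S (Suc n) - S n" for n
    have \<Delta>: "finite (\<Delta> n)" "\<Delta> n \<subseteq> topspace X" for n
      unfolding \<Delta>_def using S(3,4) by auto
    have disj: "\<Delta> m \<inter> \<Delta> n = {}" if "m < n" for m n
      using monoD[OF S(2), of "Suc m" n] that unfolding \<Delta>_def by auto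
    have "disjoint_family \<Delta>"
      unfolding disjoint_family_on_def
    proof (intro ballI impI)
      fix m n :: nat assume "m \<noteq> n"
      then consider "m < n" | "n < m" by linarith
      then show "\<Delta> m \<inter> \<Delta> n = {}" using disj by cases blast+
    qed
    have "\<exists>A. A \<subseteq> (\<Union>n. \<Delta> n) \<and> Coz_delta_separated X A \<and> (\<forall>i. \<exists>n\<ge>i. \<Delta> n \<subseteq> A)"
    \<comment> \<open>If almost all \<open>\<Delta> n\<close> are empty (as happens for finite \<open>X\<close>), then \<open>A = {}\<close> will do.\<close>
    proof (cases "infinite {n. \<Delta> n \<noteq> {}}")
      case True
      define e where "e = enumerate {n. \<Delta> n \<noteq> {}}"
      have e: "strict_mono e" "\<And>n. \<Delta> (e n) \<noteq> {}"
        unfolding e_def using strict_mono_enumerate[OF True] enumerate_in_set[OF True] by auto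
      have "disjoint_family (\<lambda>n. \<Delta> (e n))"
        using \<open>disjoint_family \<Delta>\<close> strict_mono_eq[OF e(1)] unfolding disjoint_family_on_def by simp
      then obtain r :: "nat \<Rightarrow> nat"
        where r: "strict_mono r" "Coz_delta_separated X (\<Union>k. \<Delta> (e (r k)))"
        using sep[of "\<lambda>n. \<Delta> (e n)", OF e(2) \<Delta>] by blast
      have "i \<le> e (r i)" for i
        using strict_mono_imp_increasing[OF e(1), of "r i"] strict_mono_imp_increasing[OF r(1), of i]
        by linarith
      then show ?thesis using r(2) by (intro exI[of _ "\<Union>k. \<Delta> (e (r k))"]) blast
    next
      case False
      then obtain N where "\<forall>n. \<Delta> n \<noteq> {} \<longrightarrow> n < N"
        by (auto simp: finite_nat_set_iff_bounded)
      then have "\<Delta> (max i N) = {}" for i by (metis max.cobounded2 not_less)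
      then have "\<exists>n\<ge>i. \<Delta> n \<subseteq> {}" for i by (intro exI[of _ "max i N"]) simp
      then show ?thesis using Coz_delta_separated_empty by blast
    qed
    then obtain A where A: "A \<subseteq> (\<Union>n. \<Delta> n)" "Coz_delta_separated X A" "\<And>i. \<exists>n\<ge>i. \<Delta> n \<subseteq> A"
      by blast
    have "(\<Union>n. \<Delta> n) \<subseteq> (\<Union>n. S n)" unfolding \<Delta>_def by blast
    with A(1) have "A \<subseteq> (\<Union>n. S n)" by (rule order_trans)
    moreover have "countable (\<Union>n. S n)" using S(3) by (simp add: countable_finite)
    moreover have "(\<Union>n. S n) \<subseteq> topspace X" using S(4) by (intro UN_least)
    ultimately have D: "countable (\<Union>n. S n)" "(\<Union>n. S n) \<subseteq> topspace X" "A \<subseteq> (\<Union>n. S n)"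
      by simp_all
    obtain f where f: "f \<in> stable_Baire_one X"
      "\<And>x. x \<in> (\<Union>n. S n) \<Longrightarrow> f x = w x + (if x \<in> A then q x else 0)"
      by (rule Coz_delta_separated_prescribed_values[OF X A(2) D w, where q = q]) (rule that)
    have "f \<in> G i" for i
    proof -
      obtain n where n: "i \<le> n" "\<Delta> n \<subseteq> A" using A(3) by blast
      show ?thesis
      proof (rule in_G[rule_format, OF n(1), of "A \<inter> S n"])
        show "f x = w x + q x" if "x \<in> S (Suc n) - S n" for x
        proof -
          have "x \<in> (\<Union>n. S n)" "x \<in> A" using that n(2) unfolding \<Delta>_def by auto
          then show ?thesis using f(2) by simp
        qed
        show "f x = w x + (if x \<in> A \<inter> S n then q x else 0)" if "x \<in> S n" for x
        proof -
          have "x \<in> (\<Union>n. S n)" using that by blast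
          from f(2)[OF this] show ?thesis using that by simp
        qed
      qed (use f(1) E(1) in auto)
    qed
    moreover have "\<bar>f x - f0 x\<bar> < \<epsilon>" if "x \<in> S0" for x
    proof -
      have "x \<notin> \<Delta> n" for n using monoD[OF S(2), of 0 n] that S(1) unfolding \<Delta>_def by auto
      then have "x \<notin> A" using A(1) by auto
      moreover have "x \<in> (\<Union>n. S n)" using that S(1) by auto
      ultimately have "f x = w x" using f(2) by simp
      moreover have "\<bar>w x - w0 x\<bar> \<le> \<epsilon> / 2" using w_near that S0(2) by blast
      ultimately show ?thesis using w0(2)[OF that] \<open>0 < \<epsilon>\<close> by linarith
    qed
    ultimately show ?thesis by blast
  qed
  then show "subtopology (powertop_real (topspace X)) E closure_of (\<Inter>n. G n) =
      topspace (subtopology (powertop_real (topspace X)) E)"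
    unfolding dense_pointwise_iff[OF E(2) \<open>(\<Inter>n. G n) \<subseteq> E\<close>] by blast
qed

text \<open>Both function spaces of the theorem, and everything between them, are covered by one equivalence;
  this also shows that their Baire properties are equivalent, without comparing the spaces directly.\<close>

theorem Baire_iff_Coz_delta_separated_subsequences:
  fixes X :: "'a topology"
  assumes X: "Tychonoff_space X" and E: "stable_Baire_one X \<subseteq> E" "E \<subseteq> Baire_one X"
  shows "Baire_space (subtopology (powertop_real (topspace X)) E) \<longleftrightarrow>
    (\<forall>\<Delta> :: nat \<Rightarrow> 'a set.
       (\<forall>n. \<Delta> n \<noteq> {} \<and> finite (\<Delta> n) \<and> \<Delta> n \<subseteq> topspace X) \<and> disjoint_family \<Delta> \<longrightarrow>
       (\<exists>r :: nat \<Rightarrow> nat. strict_mono r \<and> Coz_delta_separated X (\<Union>k. \<Delta> (r k))))"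
    (is "?L \<longleftrightarrow> ?R")
proof
  assume ?L
  then show ?R using Baire_imp_Coz_delta_separated_subsequence[OF X E] by simp
next
  assume ?R
  have "E \<subseteq> extensional (topspace X)" using E(2) unfolding Baire_one_def by blast
  from Baire_if_Coz_delta_separated_subsequences[OF X E(1) this] \<open>?R\<close> show ?L by simp
qed

theorem theorem1p4:
  fixes X :: "'a topology"
  assumes "Tychonoff_space X"
  shows "(Baire_space (B1_space X) \<longleftrightarrow> Baire_space (B1st_space X)) \<and>
    (Baire_space (B1st_space X) \<longleftrightarrow>
       (\<forall>\<Delta> :: nat \<Rightarrow> 'a set.
          (\<forall>n. \<Delta> n \<noteq> {} \<and> finite (\<Delta> n) \<and> \<Delta> n \<subseteq> topspace X) \<and> disjoint_family \<Delta> \<longrightarrow>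
          (\<exists>r :: nat \<Rightarrow> nat. strict_mono r \<and>
             (let A = (\<Union>k. \<Delta> (r k)) in
                \<exists>F :: 'a \<Rightarrow> 'a set.
                  disjoint_family_on F A \<and>
                  (\<forall>a \<in> A. zero_set_nbhd X a (F a)) \<and>
                  completely_Coz_delta_additive X A F))))"
  using Baire_iff_Coz_delta_separated_subsequences[OF assms order.refl stable_Baire_one_subset_Baire_one]
    Baire_iff_Coz_delta_separated_subsequences[OF assms stable_Baire_one_subset_Baire_one order.refl]
  unfolding B1_space_def B1st_space_def Let_def Coz_delta_separated_def by simp

end
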